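(* Every distributive $\langle\vee,0\rangle$-semilattice of size at most $\aleph_1$ is isomorphic to the $\langle\vee,0\rangle$-semilattice $\mathrm{Sub_c}\,M$ of all finitely generated submodules of some right module $M$ over some ring.
   Context: A $\langle\vee,0\rangle$-semilattice $S$ is distributive if for all $a,b,c\in S$ with $c\leq a\vee b$ there are $a'\leq a$ and $b'\leq b$ in $S$ such that $c=a'\vee b'$. For a right module $M$, $\mathrm{Sub_c}\,M$ is the $\langle\vee,0\rangle$-semilattice of all finitely generated submodules of $M$ under sum. *)

theory Defs
  imports "HOL-Algebra.Module" "HOL-Algebra.AbelCoset"
begin

unbundle cardinal_syntax

class distributive_semilattice_sup_bot = bounded_semilattice_sup_bot +
  assumes sup_distributive:
    "c \<le> sup a b \<Longrightarrow> \<exists>a' b'. a' \<le> a \<and> b' \<le> b \<and> c = sup a' b'"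

text \<open>
  The library locale \<open>module\<close> requires a commutative ring. Here rings are associative and unital,
  but need not be commutative. The library's record is reused, with \<open>a \<odot>\<^bsub>M\<^esub> x\<close> standing for the
  right action \<open>x \<cdot> a\<close>; hence the order of the scalars in \<open>smult_assoc\<close>, which is the law
  \<open>x \<cdot> (a b) = (x \<cdot> a) \<cdot> b\<close>.
\<close>

locale right_module = R?: ring R + M?: abelian_group M
  for R :: "('r, 'c) ring_scheme" (structure) and M :: "('r, 'm, 'd) module_scheme" (structure) +
  assumes smult_closed:
      "\<lbrakk>a \<in> carrier R; x \<in> carrier M\<rbrakk> \<Longrightarrow> a \<odot>\<^bsub>M\<^esub> x \<in> carrier M"
    and smult_l_distr:
      "\<lbrakk>a \<in> carrier R; b \<in> carrier R; x \<in> carrier M\<rbrakk>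
        \<Longrightarrow> (a \<oplus>\<^bsub>R\<^esub> b) \<odot>\<^bsub>M\<^esub> x = (a \<odot>\<^bsub>M\<^esub> x) \<oplus>\<^bsub>M\<^esub> (b \<odot>\<^bsub>M\<^esub> x)"
    and smult_r_distr:
      "\<lbrakk>a \<in> carrier R; x \<in> carrier M; y \<in> carrier M\<rbrakk>
        \<Longrightarrow> a \<odot>\<^bsub>M\<^esub> (x \<oplus>\<^bsub>M\<^esub> y) = (a \<odot>\<^bsub>M\<^esub> x) \<oplus>\<^bsub>M\<^esub> (a \<odot>\<^bsub>M\<^esub> y)"
    and smult_assoc:
      "\<lbrakk>a \<in> carrier R; b \<in> carrier R; x \<in> carrier M\<rbrakk>
        \<Longrightarrow> (a \<otimes>\<^bsub>R\<^esub> b) \<odot>\<^bsub>M\<^esub> x = b \<odot>\<^bsub>M\<^esub> (a \<odot>\<^bsub>M\<^esub> x)"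
    and smult_one:
      "x \<in> carrier M \<Longrightarrow> \<one>\<^bsub>R\<^esub> \<odot>\<^bsub>M\<^esub> x = x"

text \<open>
  The library predicate \<open>submodule\<close> only asks for an additive subgroup closed under scalars, so it
  applies to right modules as well.
\<close>

definition submodule_span ::
  "('r, 'c) ring_scheme \<Rightarrow> ('r, 'm, 'd) module_scheme \<Rightarrow> 'm set \<Rightarrow> 'm set" where
  "submodule_span R M X = \<Inter> {N. submodule N R M \<and> X \<subseteq> N}"

definition Sub\<^sub>c :: "('r, 'c) ring_scheme \<Rightarrow> ('r, 'm, 'd) module_scheme \<Rightarrow> 'm set set" where
  "Sub\<^sub>c R M = {submodule_span R M X | X. finite X \<and> X \<subseteq> carrier M}"

definition Sub\<^sub>c_iso ::
  "('r, 'c) ring_scheme \<Rightarrow> ('r, 'm, 'd) module_scheme \<Rightarrow>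
    ('a::bounded_semilattice_sup_bot \<Rightarrow> 'm set) \<Rightarrow> bool" where
  "Sub\<^sub>c_iso R M \<phi> \<longleftrightarrow>
     bij_betw \<phi> UNIV (Sub\<^sub>c R M) \<and>
     (\<forall>a b. \<phi> (sup a b) = \<phi> a <+>\<^bsub>M\<^esub> \<phi> b) \<and>
     \<phi> bot = {\<zero>\<^bsub>M\<^esub>}"

text \<open>
  HOL cannot quantify existentially over types, so the ring and the module have to live on fixed
  types, which must be large enough. By a Loewenheim-Skolem argument, a representation of a
  semilattice \<open>'a\<close> over any ring and module whatsoever yields one in which the ring and the module
  have cardinality at most \<open>max |'a| \<aleph>\<^sub>0\<close>, and both types below are at least that large. The
  carriers remain arbitrary subsets.
\<close>

type_synonym 'a vec = "('a + nat) set"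
type_synonym 'a scal = "'a vec \<Rightarrow> 'a vec"

end

theory Submission
  imports Defs "HOL.Vector_Spaces" "HOL-Library.Z2" "HOL-Library.Function_Algebras" "HOL-Library.Countable_Set"
begin

text \<open>
  The semilattice \<open>S\<close> is realised by a vector space \<open>W\<close> over the field with two elements and a map
  \<open>\<Phi>\<close> from \<open>W\<close> onto \<open>S\<close>, where \<open>\<Phi> x\<close> is meant to be the element of \<open>S\<close> that corresponds to the
  submodule generated by \<open>x\<close>. The ring consists of all additive maps that do not increase \<open>\<Phi>\<close>. Two
  properties make this work: if \<open>\<Phi> y \<le> \<Phi> x\<close>, then some operator of the ring takes \<open>x\<close> to \<open>y\<close>; and
  if \<open>\<Phi> y \<le> sup a b\<close>, then \<open>y\<close> is the sum of a vector of value at most \<open>a\<close> and one of value at most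
  \<open>b\<close>. The finitely generated submodules are then the sets \<open>{x. \<Phi> x \<le> a}\<close>
  (\<open>module_of_valuation\<close>).

  For a finite Boolean semilattice, the subsets of a finite set \<open>I\<close>, one takes a direct sum of spaces
  indexed by \<open>I\<close> and lets \<open>\<Phi>\<close> be the support. A distributive semilattice is locally a limit of such
  semilattices: a finite family in \<open>S\<close>, seen as a homomorphism from a finite Boolean semilattice to
  \<open>S\<close>, factors through a finite Boolean semilattice in which all inequalities between the
  values already hold (\<open>boolean_refinement\<close>). The space \<open>W\<close> is accordingly built as a directed union
  of finite pieces. A piece is a finite vector space with finitely many coordinate maps, a value
  in \<open>S\<close> for each coordinate, and some operators that respect the coordinates. Enlarging a piece
  brings in the operators and the decompositions that the two properties ask for.

  The crucial step is that two pieces \<open>B\<close> and \<open>C\<close> that meet in a common subpiece \<open>A\<close> embed into one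
  piece in a compatible way (\<open>amalgamation\<close>). At the level of \<open>S\<close> this holds because the Boolean
  refinement identifies any two sets of coordinates with the same supremum. At the level of vector
  spaces it holds because two extensions of a vector space can always be glued along it, and because
  operators can be extended along projections.

  Only two pieces are glued at a time, and this is where the bound \<open>\<aleph>\<^sub>1\<close> enters. A countable directed
  system of pieces contains a cofinal chain \<open>P\<^sub>0, P\<^sub>1, \<dots>\<close>, and it is enlarged by a ladder:
  \<open>Q\<^sub>n\<^sub>+\<^sub>1\<close> is the amalgam of \<open>Q\<^sub>n\<close> and \<open>P\<^sub>n\<^sub>+\<^sub>1\<close> over \<open>P\<^sub>n\<close>
  (\<open>extend_countable_system\<close>). A well-order in which all proper initial segments are countable then
  lets one repeat this transfinitely until every element of \<open>S\<close> is reached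
  (\<open>directed_system_exists\<close>).

  One point is treated differently from the sketch. In a direct sum, vectors of \<open>B\<close> and \<open>C\<close> outside
  \<open>A\<close> may be forced to coincide in the amalgam. To keep all spaces literally inside each other and to
  have \<open>B \<inter> C = A\<close>, such vectors stay distinct and merely have the same coordinates. So nonzero vectors
  may have value \<open>bot\<close>; these are divided out at the very end (\<open>module_valuation_exists\<close>).
\<close>

section \<open>Vector spaces over the field with two elements\<close>

text \<open>
  Over the field with two elements additive maps are automatically linear, and additive subgroups
  are subspaces. So scalars occur only where bases are needed.
\<close>

type_synonym 'x bvec = "'x \<Rightarrow> bit"

lemma bvec_add_self [simp]: "(v :: 'x bvec) + v = 0"
  by (rule ext) simp

lemma bvec_add_cancel [simp]: "(v :: 'x bvec) + (v + w) = w"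
  by (simp flip: add.assoc)

lemma bvec_add_eq_0_iff [simp]: "(v :: 'x bvec) + w = 0 \<longleftrightarrow> v = w"
  by (metis bvec_add_cancel bvec_add_self add_0_right)

definition bscale :: "bit \<Rightarrow> 'x bvec \<Rightarrow> 'x bvec" where
  "bscale c v = (\<lambda>x. c * v x)"

lemma bscale_cases: "bscale c v = (if c = 0 then 0 else v)"
  by (auto simp: bscale_def fun_eq_iff)

interpretation F2: vector_space bscale
  by unfold_locales (auto simp: bscale_def fun_eq_iff algebra_simps)

interpretation F2p: vector_space_pair bscale bscale
  by unfold_locales

definition lin_sub :: "'x bvec set \<Rightarrow> bool" where
  "lin_sub K \<longleftrightarrow> 0 \<in> K \<and> (\<forall>v\<in>K. \<forall>w\<in>K. v + w \<in> K)"

lemma lin_sub_iff_subspace: "lin_sub K \<longleftrightarrow> F2.subspace K"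
  unfolding lin_sub_def F2.subspace_def bscale_cases by auto

lemma additive_iff_linear:
  "additive f \<longleftrightarrow> Vector_Spaces.linear bscale bscale f"
proof
  assume "additive f"
  then interpret additive f .
  show "Vector_Spaces.linear bscale bscale f"
    unfolding Vector_Spaces.linear_iff by (simp add: add bscale_cases zero F2.vector_space_axioms)
next
  assume "Vector_Spaces.linear bscale bscale f"
  then interpret Vector_Spaces.linear bscale bscale f .
  show "additive f" by (rule additive.intro) (rule add)
qed

lemma lin_sub_0: "lin_sub K \<Longrightarrow> 0 \<in> K"
  and lin_sub_add: "lin_sub K \<Longrightarrow> v \<in> K \<Longrightarrow> w \<in> K \<Longrightarrow> v + w \<in> K"
  by (auto simp: lin_sub_def)

lemma lin_sub_sum: "lin_sub K \<Longrightarrow> (\<And>i. i \<in> A \<Longrightarrow> f i \<in> K) \<Longrightarrow> sum f A \<in> K"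
  by (induction A rule: infinite_finite_induct) (auto simp: lin_sub_0 lin_sub_add)

lemma additive_id: "additive (\<lambda>v. v)"
  by (simp add: additive_def)

lemma additive_add: "additive f \<Longrightarrow> additive g \<Longrightarrow> additive (\<lambda>v. f v + g v)"
  by (simp add: additive_def algebra_simps)

lemma additive_compose: "additive f \<Longrightarrow> additive g \<Longrightarrow> additive (\<lambda>v. f (g v))"
  by (simp add: additive_def)

lemma additive_sum: "(\<And>i. i \<in> A \<Longrightarrow> additive (f i)) \<Longrightarrow> additive (\<lambda>v. \<Sum>i\<in>A. f i v)"
  by (simp add: additive_def sum.distrib)

lemma additive_left_inverse_on:
  fixes f :: "'x bvec \<Rightarrow> 'x bvec"
  assumes "additive f" "lin_sub V" "inj_on f V"
  shows "\<exists>g. additive g \<and> (\<forall>v. g v \<in> V) \<and> (\<forall>v\<in>V. g (f v) = v)"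
  using F2p.linear_exists_left_inverse_on[of f V] assms
  unfolding additive_iff_linear lin_sub_iff_subspace by blast

lemma projection_exists:
  fixes V :: "'x bvec set"
  assumes "lin_sub V"
  obtains g where "additive g" "\<And>v. g v \<in> V" "\<And>v. v \<in> V \<Longrightarrow> g v = v"
  using additive_left_inverse_on[OF additive_id assms] inj_on_id2 by metis

text \<open>
  A projection \<open>r\<close> onto \<open>B\<close> can be chosen to respect a second subspace \<open>K\<close>. If \<open>W\<close> is a complement of
  \<open>B \<inter> K\<close> in \<open>K\<close>, then \<open>W\<close> meets \<open>B\<close> only in \<open>0\<close>, so \<open>r\<close> can be made to vanish on \<open>W\<close>, which leaves
  \<open>r ` K = B \<inter> K\<close>. This is the source of all extensions of operators below.
\<close>

lemma projection_preserving:
  fixes B K :: "'x bvec set"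
  assumes B: "lin_sub B" and K: "lin_sub K"
  obtains r where "additive r" "\<And>v. r v \<in> B" "\<And>v. v \<in> B \<Longrightarrow> r v = v" "\<And>v. v \<in> K \<Longrightarrow> r v \<in> K"
proof -
  have BK: "lin_sub (B \<inter> K)" using B K by (auto simp: lin_sub_def)
  obtain p where p: "additive p" "\<And>v. p v \<in> B \<inter> K" "\<And>v. v \<in> B \<inter> K \<Longrightarrow> p v = v"
    using projection_exists[OF BK] by metis
  obtain q where q: "additive q" "\<And>v. q v \<in> B" "\<And>v. v \<in> B \<Longrightarrow> q v = v"
    using projection_exists[OF B] by metis
  interpret p: additive p by fact
  interpret q: additive q by fact
  define W where "W = {v \<in> K. p v = 0}"
  have W: "lin_sub W" using K by (auto simp: W_def lin_sub_def p.add p.zero)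
  \<comment> \<open>The kernel of \<open>v \<mapsto> v + q v\<close> is \<open>B\<close>, and \<open>W\<close> is a complement of \<open>B \<inter> K\<close> in \<open>K\<close>.\<close>
  have inj: "inj_on (\<lambda>v. v + q v) W"
  proof (rule inj_onI)
    fix v w assume vw: "v \<in> W" "w \<in> W" "v + q v = w + q w"
    have d: "v + w \<in> W" using W vw by (auto simp: lin_sub_def)
    have "(v + w) + q (v + w) = (v + q v) + (w + q w)" by (simp add: q.add ac_simps)
    also have "\<dots> = 0" using vw(3) by simp
    finally have "v + w = q (v + w)" by simp
    then have "v + w \<in> B" using q(2) by metis
    then have "v + w = p (v + w)" using d p(3) by (auto simp: W_def)
    also have "\<dots> = 0" using d by (auto simp: W_def)
    finally show "v = w" by simp
  qed
  obtain g where g: "additive g" "\<And>v. g v \<in> W" "\<And>v. v \<in> W \<Longrightarrow> g (v + q v) = v"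
    using additive_left_inverse_on[OF additive_add[OF additive_id q(1)] W inj] by metis
  interpret g: additive g by fact
  show thesis
  proof
    \<comment> \<open>The map \<open>v \<mapsto> g (v + q v)\<close> vanishes on \<open>B\<close> and is the identity on \<open>W\<close>.\<close>
    show "additive (\<lambda>v. q (v + g (v + q v)))"
      by (simp add: additive_def q.add g.add ac_simps)
    fix v
    show "q (v + g (v + q v)) \<in> B" by (rule q)
    show "q (v + g (v + q v)) = v" if "v \<in> B" using that q(3) by (simp add: g.zero)
    show "q (v + g (v + q v)) \<in> K" if "v \<in> K"
    proof -
      have w: "v + p v \<in> W" 
        using that K p(2)[of v] p(3)[of "p v"] by (auto simp: W_def lin_sub_def p.add)
      have "v + g (v + q v) = p v + ((v + p v) + g ((v + p v) + q (v + p v)) + g (p v + q (p v)))"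
        by (simp add: q.add g.add ac_simps)
      also have "\<dots> = p v" using g(3)[OF w] q(3)[of "p v"] p(2)[of v] by (simp add: g.zero)
      finally show ?thesis using q(3)[of "p v"] p(2)[of v] by auto
    qed
  qed
qed

lemma separating_additive:
  fixes K :: "'x bvec set" and z :: "'x bvec"
  assumes K: "lin_sub K" and x: "x \<notin> K"
  obtains T where "additive T" "T x = z" "\<And>v. v \<in> K \<Longrightarrow> T v = 0" "\<And>v. T v \<in> {0, z}"
proof -
  obtain q where q: "additive q" "\<And>v. q v \<in> K" "\<And>v. v \<in> K \<Longrightarrow> q v = v"
    using projection_exists[OF K] by metis
  have "x + q x \<noteq> 0" using x q(2)[of x] by auto
  then have "F2.independent {x + q x}" by simp
  then obtain g where g: "additive g" "g (x + q x) = z" "range g = F2.span {z}"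
    using F2p.linear_independent_extend_subspace[of "{x + q x}" "\<lambda>_. z"] unfolding additive_iff_linear by auto
  interpret g: additive g by fact
  interpret q: additive q by fact
  have "F2.span {z} \<subseteq> {0, z}"
    by (auto simp: F2.span_singleton bscale_cases)
  then have r: "g v \<in> {0, z}" for v using g(3) by auto
  show thesis
  proof
    show "additive (\<lambda>v. g (v + q v))"
      by (simp add: additive_def q.add g.add ac_simps)
    show "g (x + q x) = z" by fact
    show "g (v + q v) = 0" if "v \<in> K" for v using q(3) that by (simp add: g.zero)
    show "g (v + q v) \<in> {0, z}" for v by (rule r)
  qed
qed

section \<open>Refinement of finite families in a distributive semilattice\<close>

text \<open>
  A relational form of suprema: the semilattice has joins of finite sets only, and in this form
  suprema of images and of unions can be handled by logic alone.
\<close>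

definition is_lub :: "'a::order \<Rightarrow> 'a set \<Rightarrow> bool" where
  "is_lub s A \<longleftrightarrow> (\<forall>d. s \<le> d \<longleftrightarrow> (\<forall>a\<in>A. a \<le> d))"

lemma finite_is_lub_exists:
  fixes A :: "'a::bounded_semilattice_sup_bot set"
  assumes "finite A"
  shows "\<exists>s. is_lub s A"
  using assms
proof induction
  case empty
  show ?case by (auto simp: is_lub_def intro: exI[of _ bot])
next
  case (insert a A)
  then obtain s where "is_lub s A" by blast
  then have "is_lub (sup a s) (insert a A)" by (auto simp: is_lub_def)
  then show ?case ..
qed

text \<open>
  The defining property of distributivity, extended from two summands to finitely many.
\<close>

lemma distributive_refinement:
  fixes v :: "'k \<Rightarrow> 'a::distributive_semilattice_sup_bot"
  assumes "finite B" "\<And>d. \<forall>k\<in>B. v k \<le> d \<Longrightarrow> c \<le> d"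
  shows "\<exists>c'. (\<forall>k\<in>B. c' k \<le> v k) \<and> is_lub c (c' ` B)"
  using assms
proof (induction B arbitrary: c)
  case empty
  then show ?case by (auto simp: is_lub_def)
next
  case (insert k B)
  obtain s where s: "is_lub s (v ` B)"
    using finite_is_lub_exists insert.hyps(1) by blast
  have "\<forall>k\<in>B. v k \<le> s" using s by (auto simp: is_lub_def)
  then have "\<forall>l\<in>insert k B. v l \<le> sup (v k) s" by (auto intro: le_supI2)
  then have "c \<le> sup (v k) s" by (rule insert.prems)
  then obtain x y where xy: "x \<le> v k" "y \<le> s" "c = sup x y"
    using sup_distributive by metis
  have "y \<le> d" if "\<forall>k\<in>B. v k \<le> d" for d
    using that s xy(2) by (auto simp: is_lub_def intro: order_trans)
  then obtain c' where c': "\<forall>k\<in>B. c' k \<le> v k" "is_lub y (c' ` B)"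
    using insert.IH by blast
  have "(c'(k := x)) ` insert k B = insert x (c' ` B)" using insert.hyps(2) by auto
  then have "is_lub c ((c'(k := x)) ` insert k B)"
    using c'(2) xy(3) by (auto simp: is_lub_def)
  moreover have "\<forall>l\<in>insert k B. (c'(k := x)) l \<le> v l" using c'(1) xy(1) by auto
  ultimately show ?case by blast
qed

lemma is_lub_UN:
  assumes "\<And>i. i \<in> A \<Longrightarrow> is_lub (v i) (F i)" "is_lub s (v ` A)"
  shows "is_lub s (\<Union>i\<in>A. F i)"
  using assms by (auto simp: is_lub_def)

text \<open>
  An inequality \<open>sup \<gamma> A \<le> sup \<gamma> B\<close> between values is made to hold between sets of indices. Each
  \<open>j \<in> A - B\<close> is replaced by indices \<open>(j, k)\<close> with \<open>k \<in> B\<close>, whose values \<open>c j k\<close> refine the inequality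
  \<open>\<gamma> j \<le> sup \<gamma> B\<close>. The index \<open>(j, k)\<close> may also be put below \<open>k\<close>, because \<open>c j k \<le> \<gamma> k\<close>, and then all
  of \<open>A\<close> lies below \<open>B\<close>. The pair \<open>(k, k)\<close> stands for an old index \<open>k\<close> that is kept.
\<close>

lemma split_one_inequality:
  fixes \<gamma> :: "nat \<Rightarrow> 'a::distributive_semilattice_sup_bot"
  assumes J: "finite J" "A \<subseteq> J" "B \<subseteq> J" and le: "\<And>d. \<forall>k\<in>B. \<gamma> k \<le> d \<Longrightarrow> \<forall>j\<in>A. \<gamma> j \<le> d"
  shows "\<exists>(J'::nat set) \<gamma>' \<psi>. finite J' \<and> (\<forall>j\<in>J. \<psi> j \<subseteq> J' \<and> is_lub (\<gamma> j) (\<gamma>' ` \<psi> j)) \<and>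
           (\<Union>j\<in>A. \<psi> j) \<subseteq> (\<Union>k\<in>B. \<psi> k)"
proof -
  have fB: "finite B" using J finite_subset by blast
  have "\<exists>c'. (\<forall>k\<in>B. c' k \<le> \<gamma> k) \<and> is_lub (\<gamma> j) (c' ` B)" if "j \<in> A" for j
    using that le by (intro distributive_refinement fB) blast
  then obtain c where c: "\<And>j k. j \<in> A \<Longrightarrow> k \<in> B \<Longrightarrow> c j k \<le> \<gamma> k" "\<And>j. j \<in> A \<Longrightarrow> is_lub (\<gamma> j) (c j ` B)"
    by metis
  define P where "P = (\<lambda>k. (k, k)) ` (J - (A - B)) \<union> (A - B) \<times> B"
  define \<delta> where "\<delta> p = (if fst p = snd p then \<gamma> (fst p) else c (fst p) (snd p))" for p
  define \<psi> where "\<psi> k = {p \<in> P. fst p = k \<or> snd p = k}" for k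
  have fP: "finite P" using J fB finite_subset[of A J] by (auto simp: P_def)
  then obtain h :: "nat \<times> nat \<Rightarrow> nat" where h: "inj_on h P"
    using finite_imp_inj_to_nat_seg by blast
  have lub: "is_lub (\<gamma> j) (\<delta> ` \<psi> j)" if j: "j \<in> J" for j
  proof (cases "j \<in> A - B")
    case True
    then have "\<psi> j = {j} \<times> B" by (auto simp: \<psi>_def P_def)
    then have "\<psi> j = (\<lambda>k. (j, k)) ` B" by auto
    moreover have "\<delta> (j, k) = c j k" if "k \<in> B" for k using that True by (auto simp: \<delta>_def)
    ultimately have "\<delta> ` \<psi> j = c j ` B" by (simp add: image_image)
    then show ?thesis using c(2) True by auto
  next
    case False
    then have "(j, j) \<in> \<psi> j" using j by (auto simp: \<psi>_def P_def)
    moreover have "\<delta> p \<le> \<gamma> j" if "p \<in> \<psi> j" for p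
      using that False c(1) by (auto simp: \<psi>_def P_def \<delta>_def)
    moreover have "\<delta> (j, j) = \<gamma> j" by (simp add: \<delta>_def)
    ultimately show ?thesis unfolding is_lub_def by (metis (no_types, lifting) image_iff order_trans)
  qed
  have sub: "(\<Union>j\<in>A. \<psi> j) \<subseteq> (\<Union>k\<in>B. \<psi> k)"
    by (auto simp: \<psi>_def P_def)
  let ?\<gamma> = "\<lambda>n. \<delta> (the_inv_into P h n)"
  have im: "?\<gamma> ` h ` \<psi> j = \<delta> ` \<psi> j" for j
    unfolding image_image
    by (rule image_cong) (auto simp: \<psi>_def the_inv_into_f_f[OF h])
  show ?thesis
  proof (rule exI[of _ "h ` P"], rule exI[of _ ?\<gamma>], rule exI[of _ "\<lambda>j. h ` \<psi> j"], intro conjI ballI)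
    show "finite (h ` P)" using fP by simp
    show "h ` \<psi> j \<subseteq> h ` P" for j by (auto simp: \<psi>_def)
    show "is_lub (\<gamma> j) (?\<gamma> ` h ` \<psi> j)" if "j \<in> J" for j unfolding im using that by (rule lub)
    show "(\<Union>j\<in>A. h ` \<psi> j) \<subseteq> (\<Union>k\<in>B. h ` \<psi> k)" using sub by blast
  qed
qed

text \<open>
  The inequalities are treated one after another. Those treated earlier survive, since a map of the
  form \<open>a \<mapsto> \<Union>j\<in>a. \<psi> j\<close> is monotone.
\<close>

lemma boolean_refinement_constraints:
  fixes \<beta> :: "'i \<Rightarrow> 'a::distributive_semilattice_sup_bot"
  assumes "finite C" and I: "finite I"
    and C: "\<And>i b. (i, b) \<in> C \<Longrightarrow> i \<in> I \<and> b \<subseteq> I \<and> (\<forall>d. (\<forall>k\<in>b. \<beta> k \<le> d) \<longrightarrow> \<beta> i \<le> d)"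
  shows "\<exists>(J::nat set) \<gamma> \<phi>. finite J \<and> (\<forall>i\<in>I. \<phi> i \<subseteq> J \<and> is_lub (\<beta> i) (\<gamma> ` \<phi> i)) \<and>
           (\<forall>(i, b)\<in>C. \<phi> i \<subseteq> (\<Union>k\<in>b. \<phi> k))"
  using assms(1) C
proof induction
  case empty
  obtain h :: "'i \<Rightarrow> nat" where h: "inj_on h I"
    using finite_imp_inj_to_nat_seg[OF I] by blast
  show ?case
    using I h
    by (intro exI[of _ "h ` I"] exI[of _ "\<lambda>n. \<beta> (the_inv_into I h n)"] exI[of _ "\<lambda>i. {h i}"]) (auto simp: is_lub_def the_inv_into_f_f)
next
  case (insert ib C)
  obtain i b where ib: "ib = (i, b)" by (cases ib)
  obtain J :: "nat set" and \<gamma> \<phi> where *: "finite J" "\<And>i. i \<in> I \<Longrightarrow> \<phi> i \<subseteq> J"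
      "\<And>i. i \<in> I \<Longrightarrow> is_lub (\<beta> i) (\<gamma> ` \<phi> i)" "\<And>i b. (i, b) \<in> C \<Longrightarrow> \<phi> i \<subseteq> (\<Union>k\<in>b. \<phi> k)"
  proof -
    have "\<exists>(J::nat set) \<gamma> \<phi>. finite J \<and> (\<forall>i\<in>I. \<phi> i \<subseteq> J \<and> is_lub (\<beta> i) (\<gamma> ` \<phi> i)) \<and>
           (\<forall>(i, b)\<in>C. \<phi> i \<subseteq> (\<Union>k\<in>b. \<phi> k))"
      by (rule insert.IH) (rule insert.prems, simp)
    then obtain J :: "nat set" and \<gamma> \<phi> where "finite J" "\<forall>i\<in>I. \<phi> i \<subseteq> J \<and> is_lub (\<beta> i) (\<gamma> ` \<phi> i)"
      "\<forall>(i, b)\<in>C. \<phi> i \<subseteq> (\<Union>k\<in>b. \<phi> k)"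
      by (elim exE conjE)
    then show thesis by (intro that[of J \<phi> \<gamma>]) auto
  qed
  have i: "i \<in> I" "b \<subseteq> I" "\<And>d. (\<forall>k\<in>b. \<beta> k \<le> d) \<Longrightarrow> \<beta> i \<le> d"
    using insert.prems[of i b] ib by auto
  have "\<exists>(J'::nat set) \<gamma>' \<psi>. finite J' \<and> (\<forall>j\<in>J. \<psi> j \<subseteq> J' \<and> is_lub (\<gamma> j) (\<gamma>' ` \<psi> j)) \<and>
           (\<Union>j\<in>\<phi> i. \<psi> j) \<subseteq> (\<Union>k\<in>(\<Union>k\<in>b. \<phi> k). \<psi> k)"
  proof (rule split_one_inequality[OF *(1)])
    show "\<phi> i \<subseteq> J" "(\<Union>k\<in>b. \<phi> k) \<subseteq> J" using *(2) i by auto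
    fix d assume "\<forall>k\<in>(\<Union>k\<in>b. \<phi> k). \<gamma> k \<le> d"
    then have "\<forall>k\<in>b. \<beta> k \<le> d" using *(3) i(2) unfolding is_lub_def by blast
    then have "\<beta> i \<le> d" by (rule i)
    then show "\<forall>j\<in>\<phi> i. \<gamma> j \<le> d" using *(3)[OF i(1)] by (auto simp: is_lub_def)
  qed
  then obtain J' :: "nat set" and \<gamma>' \<psi> where **: "finite J'" "\<And>j. j \<in> J \<Longrightarrow> \<psi> j \<subseteq> J'"
      "\<And>j. j \<in> J \<Longrightarrow> is_lub (\<gamma> j) (\<gamma>' ` \<psi> j)" "(\<Union>j\<in>\<phi> i. \<psi> j) \<subseteq> (\<Union>k\<in>(\<Union>k\<in>b. \<phi> k). \<psi> k)"
    by blast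
  have 1: "is_lub (\<beta> l) (\<gamma>' ` (\<Union>j\<in>\<phi> l. \<psi> j))" if "l \<in> I" for l
    unfolding image_UN by (rule is_lub_UN[OF **(3) *(3)]) (use that *(2) in auto)
  show ?case
  proof (rule exI[of _ J'], rule exI[of _ \<gamma>'], rule exI[of _ "\<lambda>l. \<Union>j\<in>\<phi> l. \<psi> j"], intro conjI ballI)
    show "finite J'" by fact
    show "(\<Union>j\<in>\<phi> l. \<psi> j) \<subseteq> J'" if "l \<in> I" for l using that *(2) **(2) by blast
    show "is_lub (\<beta> l) (\<gamma>' ` (\<Union>j\<in>\<phi> l. \<psi> j))" if "l \<in> I" for l using that by (rule 1)
    fix z assume z: "z \<in> insert ib C"
    obtain l c where zl: "z = (l, c)" by (cases z)
    have "(\<Union>j\<in>\<phi> l. \<psi> j) \<subseteq> (\<Union>k\<in>c. \<Union>j\<in>\<phi> k. \<psi> j)"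
    proof (cases "z = ib")
      case True
      then show ?thesis using **(4) ib zl by simp
    next
      case False
      then have "\<phi> l \<subseteq> (\<Union>k\<in>c. \<phi> k)" using z zl *(4) by blast
      then show ?thesis by blast
    qed
    then show "case z of (l, c) \<Rightarrow> (\<Union>j\<in>\<phi> l. \<psi> j) \<subseteq> (\<Union>k\<in>c. \<Union>j\<in>\<phi> k. \<psi> j)" using zl by simp
  qed
qed

text \<open>
  Seen algebraically, the homomorphism from the subsets of \<open>I\<close> to \<open>S\<close> given by \<open>\<beta>\<close> factors through the
  subsets of \<open>J\<close>, and the first factor already reflects every inequality that holds in \<open>S\<close>. In
  particular two sets with the same supremum get the same image; this makes squares of Boolean
  semilattices commute that only commute over \<open>S\<close>.
\<close>

lemma boolean_refinement:
  fixes \<beta> :: "'i \<Rightarrow> 'a::distributive_semilattice_sup_bot"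
  assumes I: "finite I"
  shows "\<exists>(J::nat set) \<gamma> \<phi>. finite J \<and> (\<forall>i\<in>I. \<phi> i \<subseteq> J \<and> is_lub (\<beta> i) (\<gamma> ` \<phi> i)) \<and>
    (\<forall>a b. a \<subseteq> I \<longrightarrow> b \<subseteq> I \<longrightarrow> (\<forall>d. (\<forall>k\<in>b. \<beta> k \<le> d) \<longrightarrow> (\<forall>i\<in>a. \<beta> i \<le> d)) \<longrightarrow>
       (\<Union>i\<in>a. \<phi> i) \<subseteq> (\<Union>k\<in>b. \<phi> k))"
proof -
  define C where "C = {(i, b). i \<in> I \<and> b \<subseteq> I \<and> (\<forall>d. (\<forall>k\<in>b. \<beta> k \<le> d) \<longrightarrow> \<beta> i \<le> d)}"
  have "C \<subseteq> I \<times> Pow I" by (auto simp: C_def)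
  then have fC: "finite C" using I by (auto intro: finite_subset)
  obtain J :: "nat set" and \<gamma> \<phi> where *: "finite J" "\<forall>i\<in>I. \<phi> i \<subseteq> J \<and> is_lub (\<beta> i) (\<gamma> ` \<phi> i)"
    "\<forall>(i, b)\<in>C. \<phi> i \<subseteq> (\<Union>k\<in>b. \<phi> k)"
    using boolean_refinement_constraints[OF fC I, of \<beta>] by (auto simp: C_def)
  have "(\<Union>i\<in>a. \<phi> i) \<subseteq> (\<Union>k\<in>b. \<phi> k)"
    if "a \<subseteq> I" "b \<subseteq> I" "\<forall>d. (\<forall>k\<in>b. \<beta> k \<le> d) \<longrightarrow> (\<forall>i\<in>a. \<beta> i \<le> d)" for a b
  proof -
    have "(i, b) \<in> C" if "i \<in> a" for i using that \<open>a \<subseteq> I\<close> \<open>b \<subseteq> I\<close> \<open>\<forall>d. _ d \<longrightarrow> _ d\<close> unfolding C_def by blast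
    then show ?thesis using *(3) by blast
  qed
  with *(1,2) show ?thesis by blast
qed

section \<open>Pieces and their embeddings\<close>

definition supported :: "'x set \<Rightarrow> 'x bvec set" where
  "supported X = {v. \<forall>x. v x \<noteq> 0 \<longrightarrow> x \<in> X}"

lemma lin_sub_supported: "lin_sub (supported X)"
  by (auto simp: lin_sub_def supported_def)

lemma supported_mono: "X \<subseteq> Y \<Longrightarrow> supported X \<subseteq> supported Y"
  by (auto simp: supported_def)

lemma supported_Int: "supported X \<inter> supported Y = supported (X \<inter> Y)"
  by (auto simp: supported_def)

text \<open>
  A piece is a finite stage of the construction. Its vectors are those supported in \<open>atoms\<close>. The
  coordinate with index \<open>i \<in> idx\<close> is the quotient map modulo \<open>ker i\<close>; it contributes the value \<open>val i\<close>
  to the vectors on which it does not vanish. Operators go by names, because the same operator acts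
  on larger and larger spaces as the pieces grow. A name is a pair: its first component is an atom,
  which keeps the names introduced at different stages apart, and the second component allows as
  many names as there are operators.
\<close>

record ('x, 'a) piece =
  atoms :: "'x set"
  names :: "('x \<times> ('x bvec \<Rightarrow> 'x bvec)) set"
  act :: "'x \<times> ('x bvec \<Rightarrow> 'x bvec) \<Rightarrow> 'x bvec \<Rightarrow> 'x bvec"
  idx :: "nat set"
  val :: "nat \<Rightarrow> 'a"
  ker :: "nat \<Rightarrow> 'x bvec set"

abbreviation space :: "('x, 'a) piece \<Rightarrow> 'x bvec set" where
  "space P \<equiv> supported (atoms P)"

definition preserves :: "('x, 'a) piece \<Rightarrow> ('x bvec \<Rightarrow> 'x bvec) \<Rightarrow> bool" where
  "preserves P T \<longleftrightarrow> additive T \<and> (\<forall>v\<in>space P. T v \<in> space P) \<and>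
     (\<forall>i\<in>idx P. \<forall>v\<in>ker P i. T v \<in> ker P i)"

definition valid :: "('x, 'a) piece \<Rightarrow> bool" where
  "valid P \<longleftrightarrow> finite (atoms P) \<and> finite (idx P) \<and>
     (\<forall>i\<in>idx P. lin_sub (ker P i) \<and> ker P i \<subseteq> space P) \<and>
     (\<forall>n\<in>names P. fst n \<in> atoms P \<and> preserves P (act P n))"

text \<open>
  The value of \<open>v\<close> is the supremum of \<open>val P i\<close> over the coordinates on which \<open>v\<close> does not vanish. It is
  at most \<open>d\<close> exactly if \<open>below P v d\<close>.
\<close>

definition below :: "('x, 'a::order) piece \<Rightarrow> 'x bvec \<Rightarrow> 'a \<Rightarrow> bool" where
  "below P v d \<longleftrightarrow> (\<forall>i\<in>idx P. v \<notin> ker P i \<longrightarrow> val P i \<le> d)"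

text \<open>
  The map \<open>\<phi>\<close> induces a homomorphism from the subsets of \<open>idx P\<close> to the subsets of \<open>idx Q\<close> over the
  semilattice. By the last condition this homomorphism maps the support of a vector in \<open>P\<close> to its
  support in \<open>Q\<close>, so that both pieces give it the same value.
\<close>

definition embedding :: "('x, 'a::order) piece \<Rightarrow> ('x, 'a) piece \<Rightarrow> (nat \<Rightarrow> nat set) \<Rightarrow> bool" where
  "embedding P Q \<phi> \<longleftrightarrow> atoms P \<subseteq> atoms Q \<and> names P \<subseteq> names Q \<and>
     (\<forall>n\<in>names P. \<forall>v\<in>space P. act Q n v = act P n v) \<and>
     (\<forall>i\<in>idx P. \<phi> i \<subseteq> idx Q \<and> is_lub (val P i) (val Q ` \<phi> i)) \<and>
     (\<forall>j\<in>idx Q. \<forall>v\<in>space P. v \<in> ker Q j \<longleftrightarrow> (\<forall>i\<in>idx P. j \<in> \<phi> i \<longrightarrow> v \<in> ker P i))"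

definition embeds :: "('x, 'a::order) piece \<Rightarrow> ('x, 'a) piece \<Rightarrow> bool" where
  "embeds P Q \<longleftrightarrow> (\<exists>\<phi>. embedding P Q \<phi>)"

lemma embeds_refl: "embeds P P"
  unfolding embeds_def embedding_def
  by (rule exI[of _ "\<lambda>i. {i}"]) (auto simp: is_lub_def)

lemma embeds_trans:
  assumes "embeds P Q" "embeds Q R"
  shows "embeds P R"
proof -
  obtain \<phi> \<psi> where 1: "embedding P Q \<phi>" and 2: "embedding Q R \<psi>"
    using assms unfolding embeds_def by blast
  have sub: "space P \<subseteq> space Q" using 1 by (simp add: embedding_def supported_mono)
  have "embedding P R (\<lambda>i. \<Union>j\<in>\<phi> i. \<psi> j)"
    unfolding embedding_def
  proof (intro conjI ballI)
    show "atoms P \<subseteq> atoms R" "names P \<subseteq> names R" using 1 2 unfolding embedding_def by blast+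
    show "act R n v = act P n v" if "n \<in> names P" "v \<in> space P" for n v
    proof -
      have "n \<in> names Q" "v \<in> space Q" using 1 that sub by (auto simp: embedding_def)
      then have "act R n v = act Q n v" using 2 by (simp add: embedding_def)
      also have "\<dots> = act P n v" using 1 that by (simp add: embedding_def)
      finally show ?thesis .
    qed
    fix i assume i: "i \<in> idx P"
    have \<phi>i: "\<phi> i \<subseteq> idx Q" "is_lub (val P i) (val Q ` \<phi> i)" using 1 i by (auto simp: embedding_def)
    have \<psi>: "\<psi> j \<subseteq> idx R" "is_lub (val Q j) (val R ` \<psi> j)" if "j \<in> idx Q" for j
      using 2 that by (auto simp: embedding_def)
    show "(\<Union>j\<in>\<phi> i. \<psi> j) \<subseteq> idx R" using \<phi>i \<psi> by blast
    show "is_lub (val P i) (val R ` (\<Union>j\<in>\<phi> i. \<psi> j))"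
      unfolding image_UN by (rule is_lub_UN[OF _ \<phi>i(2)]) (use \<phi>i(1) \<psi>(2) in blast)
  next
    fix k v assume k: "k \<in> idx R" and v: "v \<in> space P"
    have "v \<in> ker R k \<longleftrightarrow> (\<forall>j\<in>idx Q. k \<in> \<psi> j \<longrightarrow> v \<in> ker Q j)"
      using 2 k v sub unfolding embedding_def by blast
    also have "\<dots> \<longleftrightarrow> (\<forall>j\<in>idx Q. k \<in> \<psi> j \<longrightarrow> (\<forall>i\<in>idx P. j \<in> \<phi> i \<longrightarrow> v \<in> ker P i))"
      using 1 v unfolding embedding_def by simp
    also have "\<dots> \<longleftrightarrow> (\<forall>i\<in>idx P. k \<in> (\<Union>j\<in>\<phi> i. \<psi> j) \<longrightarrow> v \<in> ker P i)"
      using 1 unfolding embedding_def by blast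
    finally show "v \<in> ker R k \<longleftrightarrow> (\<forall>i\<in>idx P. k \<in> (\<Union>j\<in>\<phi> i. \<psi> j) \<longrightarrow> v \<in> ker P i)" .
  qed
  then show ?thesis unfolding embeds_def by blast
qed

lemma below_embedding:
  assumes e: "embedding P Q \<phi>" and v: "v \<in> space P"
  shows "below Q v d \<longleftrightarrow> below P v d"
proof -
  have "below Q v d \<longleftrightarrow> (\<forall>j\<in>idx Q. (\<exists>i\<in>idx P. j \<in> \<phi> i \<and> v \<notin> ker P i) \<longrightarrow> val Q j \<le> d)"
    using e v unfolding below_def embedding_def by simp
  also have "\<dots> \<longleftrightarrow> (\<forall>i\<in>idx P. v \<notin> ker P i \<longrightarrow> (\<forall>j\<in>\<phi> i. val Q j \<le> d))"
    using e unfolding embedding_def by blast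
  also have "\<dots> \<longleftrightarrow> below P v d"
    using e unfolding below_def embedding_def is_lub_def by simp
  finally show ?thesis .
qed

section \<open>Pieces with independent coordinates and all operators\<close>

text \<open>
  A common extension of an operator \<open>f\<close> on \<open>B\<close> (if \<open>p\<close> holds) and an operator \<open>g\<close> on \<open>C\<close> (if \<open>q\<close> holds)
  that respects one coordinate of the amalgam. If only \<open>f\<close> is given, it is composed with a projection
  onto \<open>B\<close> that takes \<open>KC\<close> into \<open>KB\<close>. If both are given, they agree on \<open>B \<inter> C\<close>, and they determine
  the extension on \<open>B + C\<close>.
\<close>

lemma extend_operator:
  fixes B C :: "'x bvec set"
  assumes B: "lin_sub B" and C: "lin_sub C"
    and KB: "lin_sub KB" "KB \<subseteq> B" and KC: "lin_sub KC" "KC \<subseteq> C"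
    and agree: "\<And>v. v \<in> B \<Longrightarrow> v \<in> C \<Longrightarrow> v \<in> KB \<longleftrightarrow> v \<in> KC"
    and f: "p \<Longrightarrow> additive f" "\<And>v. p \<Longrightarrow> v \<in> B \<Longrightarrow> f v \<in> B" "\<And>v. p \<Longrightarrow> v \<in> KB \<Longrightarrow> f v \<in> KB"
    and g: "q \<Longrightarrow> additive g" "\<And>v. q \<Longrightarrow> v \<in> C \<Longrightarrow> g v \<in> C" "\<And>v. q \<Longrightarrow> v \<in> KC \<Longrightarrow> g v \<in> KC"
    and fg: "\<And>v. p \<Longrightarrow> q \<Longrightarrow> v \<in> B \<Longrightarrow> v \<in> C \<Longrightarrow> f v = g v"
    and E: "lin_sub E" "B \<subseteq> E" "C \<subseteq> E" and K: "lin_sub K" "KB \<subseteq> K" "KC \<subseteq> K"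
  shows "\<exists>h. additive h \<and> (\<forall>v. h v \<in> E) \<and> (\<forall>v\<in>KB. h v \<in> K) \<and> (\<forall>v\<in>KC. h v \<in> K) \<and>
     (p \<longrightarrow> (\<forall>v\<in>B. h v = f v)) \<and> (q \<longrightarrow> (\<forall>v\<in>C. h v = g v))"
proof -
  consider "p" "q" | "p" "\<not> q" | "\<not> p" "q" | "\<not> p" "\<not> q" by blast
  then show ?thesis
  proof cases
    case 1
    obtain r where r: "additive r" "\<And>v. r v \<in> B" "\<And>v. v \<in> B \<Longrightarrow> r v = v" "\<And>v. v \<in> C \<Longrightarrow> r v \<in> C"
      using projection_preserving[OF B C] by metis
    obtain s where s: "additive s" "\<And>v. s v \<in> C" "\<And>v. v \<in> C \<Longrightarrow> s v = v"
      using projection_exists[OF C] by metis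
    interpret f: additive f using f 1 by blast
    interpret g: additive g using g 1 by blast
    interpret r: additive r by fact
    interpret s: additive s by fact
    let ?h = "\<lambda>v. f (r v) + g (s (v + r v))"
    have hB: "?h v = f v" if "v \<in> B" for v
      using that r(3) by (simp add: s.zero g.zero)
    have hC: "?h v = g v" if "v \<in> C" for v
    proof -
      have "v + r v \<in> C" using that r(4) C by (auto simp: lin_sub_add)
      then have "g (s (v + r v)) = g v + g (r v)" using s(3) by (simp add: g.add)
      moreover have "f (r v) = g (r v)" using fg[OF 1] r(2,4) that by blast
      ultimately have "?h v = g (r v) + (g v + g (r v))" by simp
      also have "\<dots> = g v" by (subst add.left_commute) simp
      finally show ?thesis .
    qed
    have "additive ?h" by (simp add: additive_def f.add g.add r.add s.add ac_simps)
    moreover have "?h v \<in> E" for v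
      by (rule lin_sub_add[OF E(1)]) (use f(2)[OF 1(1) r(2)] g(2)[OF 1(2) s(2)] E in blast)+
    moreover have "?h v \<in> K" if "v \<in> KB" for v
      using that f(3)[OF 1(1) that] hB[of v] subsetD[OF KB(2)] subsetD[OF K(2)] by metis
    moreover have "?h v \<in> K" if "v \<in> KC" for v
      using that g(3)[OF 1(2) that] hC[of v] subsetD[OF KC(2)] subsetD[OF K(3)] by metis
    ultimately show ?thesis using hB hC by blast
  next
    case 2
    obtain r where r: "additive r" "\<And>v. r v \<in> B" "\<And>v. v \<in> B \<Longrightarrow> r v = v" "\<And>v. v \<in> KC \<Longrightarrow> r v \<in> KC"
      using projection_preserving[OF B KC(1)] by metis
    have rK: "r v \<in> KB" if "v \<in> KC" for v
      using that r(2,4) agree KC by blast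
    show ?thesis
      by (rule exI[of _ "\<lambda>v. f (r v)"])
        (use 2 f r E K KB rK in \<open>auto simp: additive_compose subset_iff\<close>)
  next
    case 3
    obtain r where r: "additive r" "\<And>v. r v \<in> C" "\<And>v. v \<in> C \<Longrightarrow> r v = v" "\<And>v. v \<in> KB \<Longrightarrow> r v \<in> KB"
      using projection_preserving[OF C KB(1)] by metis
    have rK: "r v \<in> KC" if "v \<in> KB" for v
      using that r(2,4) agree KB by blast
    show ?thesis
      by (rule exI[of _ "\<lambda>v. g (r v)"])
        (use 3 g r E K KC rK in \<open>auto simp: additive_compose subset_iff\<close>)
  next
    case 4
    then show ?thesis
      by (intro exI[of _ "\<lambda>v. 0"]) (use E K in \<open>auto simp: additive_def lin_sub_0\<close>)
  qed
qed

text \<open>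
  Several quotient maps on one space need not be jointly surjective. They become so on a space that
  has an additional copy, embedded by \<open>\<sigma> j\<close>, of the vectors supported in \<open>X\<close> for each coordinate \<open>j\<close>:
  there \<open>\<pi> j\<close> adds the original vector and its \<open>j\<close>-th copy, so each \<open>\<pi> j\<close> can be adjusted without
  changing the others, while all of them are the identity on the original vectors. The map \<open>\<rho>\<close>
  forgets the copies.
\<close>

definition split_cover :: "'x set \<Rightarrow> nat set \<Rightarrow> 'x set \<Rightarrow> ('x bvec \<Rightarrow> 'x bvec) \<Rightarrow>
    (nat \<Rightarrow> 'x bvec \<Rightarrow> 'x bvec) \<Rightarrow> (nat \<Rightarrow> 'x bvec \<Rightarrow> 'x bvec) \<Rightarrow> bool" where
  "split_cover X J Y \<rho> \<pi> \<sigma> \<longleftrightarrow>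
     additive \<rho> \<and> (\<forall>v. \<rho> v \<in> supported X) \<and> (\<forall>v\<in>supported X. \<rho> v = v) \<and>
     (\<forall>j\<in>J. additive (\<pi> j) \<and> (\<forall>v. \<pi> j v \<in> supported X) \<and> (\<forall>v\<in>supported X. \<pi> j v = v) \<and>
        additive (\<sigma> j) \<and> (\<forall>v. \<sigma> j v \<in> supported Y) \<and>
        (\<forall>v\<in>supported X. \<forall>k\<in>J. \<pi> k (\<sigma> j v) = (if k = j then v else 0)))"

lemma split_cover_exists:
  fixes X F :: "'x set" and J :: "nat set"
  assumes X: "finite X" and F: "infinite F" and J: "finite J"
  shows "\<exists>Y \<rho> \<pi> \<sigma>. finite Y \<and> X \<subseteq> Y \<and> Y \<subseteq> X \<union> F \<and> split_cover X J Y \<rho> \<pi> \<sigma>"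
proof -
  have "finite (J \<times> X)" using J X by simp
  moreover have "infinite (F - X)" using F X by simp
  then obtain F' where "F' \<subseteq> F - X" "finite F'" "card F' = card (J \<times> X)"
    using infinite_arbitrarily_large by metis
  ultimately obtain c :: "nat \<times> 'x \<Rightarrow> 'x" where c: "inj_on c (J \<times> X)" "c ` (J \<times> X) \<subseteq> F - X"
    by (metis finite_same_card_bij bij_betw_def)
  define \<rho> :: "'x bvec \<Rightarrow> 'x bvec" where "\<rho> v x = (if x \<in> X then v x else 0)" for v x
  define \<pi> :: "nat \<Rightarrow> 'x bvec \<Rightarrow> 'x bvec" where "\<pi> j v x = (if x \<in> X then v x + v (c (j, x)) else 0)" for j v x
  define \<sigma> :: "nat \<Rightarrow> 'x bvec \<Rightarrow> 'x bvec" where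
    "\<sigma> j v y = (if \<exists>x\<in>X. y = c (j, x) then v (snd (the_inv_into (J \<times> X) c y)) else 0)" for j v y
  have cX: "c (j, x) \<notin> X" "c (j, x) \<in> F" if "j \<in> J" "x \<in> X" for j x using c(2) that by auto
  have \<sigma>1: "\<sigma> j v (c (k, x)) = (if k = j then v x else 0)" if "j \<in> J" "k \<in> J" "x \<in> X" for j k v x
  proof -
    have "(\<exists>z\<in>X. c (k, x) = c (j, z)) \<longleftrightarrow> k = j"
      using that inj_onD[OF c(1), of "(k, x)" "(j, _)"] by auto
    then show ?thesis using that by (simp add: \<sigma>_def the_inv_into_f_f[OF c(1)])
  qed
  have \<sigma>2: "\<sigma> j v x = 0" if "j \<in> J" "x \<in> X" for j v x
    using that cX by (auto simp: \<sigma>_def)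
  show ?thesis
    unfolding split_cover_def
  proof (rule exI[of _ "X \<union> c ` (J \<times> X)"], rule exI[of _ \<rho>], rule exI[of _ \<pi>], rule exI[of _ \<sigma>],
      intro conjI ballI allI)
    show "finite (X \<union> c ` (J \<times> X))" using X J by simp
    show "X \<subseteq> X \<union> c ` (J \<times> X)" "X \<union> c ` (J \<times> X) \<subseteq> X \<union> F" using c(2) by auto
    show "additive \<rho>" by (auto simp: additive_def \<rho>_def fun_eq_iff)
    show "\<rho> v \<in> supported X" for v by (auto simp: \<rho>_def supported_def)
    show "\<rho> v = v" if "v \<in> supported X" for v using that by (auto simp: \<rho>_def supported_def fun_eq_iff)
    fix j assume j: "j \<in> J"
    show "additive (\<pi> j)" by (auto simp: additive_def \<pi>_def fun_eq_iff)
    show "additive (\<sigma> j)" by (auto simp: additive_def \<sigma>_def fun_eq_iff)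
    fix v :: "'x bvec"
    show "\<pi> j v \<in> supported X" by (auto simp: \<pi>_def supported_def)
    show "\<sigma> j v \<in> supported (X \<union> c ` (J \<times> X))" using j by (auto simp: \<sigma>_def supported_def)
    assume v: "v \<in> supported X"
    show "\<pi> j v = v" using v j cX[OF j] by (fastforce simp: \<pi>_def supported_def fun_eq_iff)
    fix k assume k: "k \<in> J"
    show "\<pi> k (\<sigma> j v) = (if k = j then v else 0)"
    proof
      fix x show "\<pi> k (\<sigma> j v) x = (if k = j then v else 0) x"
        using j k v by (cases "x \<in> X") (auto simp: \<pi>_def \<sigma>1 \<sigma>2 supported_def)
    qed
  qed
qed

definition full :: "('x, 'a) piece \<Rightarrow> bool" where
  "full P \<longleftrightarrow> (\<forall>T. preserves P T \<longrightarrow> (\<exists>n\<in>names P. act P n = T))"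

text \<open>
  Independence of the coordinates, witnessed by linear maps that isolate a single coordinate.
\<close>

definition separated :: "('x, 'a) piece \<Rightarrow> (nat \<Rightarrow> 'x bvec \<Rightarrow> 'x bvec) \<Rightarrow> bool" where
  "separated P \<epsilon> \<longleftrightarrow> (\<forall>j\<in>idx P. additive (\<epsilon> j) \<and> (\<forall>v\<in>space P. \<epsilon> j v \<in> space P \<and> v + \<epsilon> j v \<in> ker P j \<and>
      (\<forall>k\<in>idx P. k \<noteq> j \<longrightarrow> \<epsilon> j v \<in> ker P k)))"

text \<open>
  Given subspaces \<open>K j\<close> that are to become the kernels of the coordinates, and partial operators
  \<open>f n\<close>, defined on \<open>Z n\<close>, that can be extended for each \<open>K j\<close> separately, the split cover carries all
  these data at once: as its coordinates are independent, the separate extensions combine to one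
  operator. Moreover, each operator that respects the coordinates gets a name whose first component
  is the fresh atom \<open>e\<close>.
\<close>

lemma full_piece_exists:
  fixes E F :: "'x set" and \<gamma> :: "nat \<Rightarrow> 'a" and N :: "('x \<times> ('x bvec \<Rightarrow> 'x bvec)) set"
  assumes E: "finite E" "e \<in> E" and F: "infinite F" and J: "finite J"
    and K: "\<And>j. j \<in> J \<Longrightarrow> lin_sub (K j) \<and> K j \<subseteq> supported E"
    and N: "\<And>n. n \<in> N \<Longrightarrow> fst n \<in> E \<and> fst n \<noteq> e"
    and h0: "\<And>n. n \<in> N \<Longrightarrow> \<exists>h. additive h \<and> (\<forall>v. h v \<in> supported E) \<and> (\<forall>v\<in>Z n. h v = f n v)"
    and hK: "\<And>n j. n \<in> N \<Longrightarrow> j \<in> J \<Longrightarrow>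
       \<exists>h. additive h \<and> (\<forall>v. h v \<in> supported E) \<and> (\<forall>v\<in>Z n. h v = f n v) \<and> (\<forall>v\<in>K j. h v \<in> K j)"
    and Z: "\<And>n. n \<in> N \<Longrightarrow> Z n \<subseteq> supported E"
  shows "\<exists>(D :: ('x, 'a) piece) \<epsilon>. valid D \<and> E \<subseteq> atoms D \<and> atoms D \<subseteq> E \<union> F \<and> idx D = J \<and> val D = \<gamma> \<and>
     N \<subseteq> names D \<and> fst ` (names D - N) \<subseteq> {e} \<and> (\<forall>n\<in>N. \<forall>v\<in>Z n. act D n v = f n v) \<and>
     (\<forall>j\<in>J. \<forall>v\<in>supported E. v \<in> ker D j \<longleftrightarrow> v \<in> K j) \<and> full D \<and> separated D \<epsilon>"
proof -
  obtain Y \<rho> \<pi> \<sigma> where Y: "finite Y" "E \<subseteq> Y" "Y \<subseteq> E \<union> F" and sc: "split_cover E J Y \<rho> \<pi> \<sigma>"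
    using split_cover_exists[OF E(1) F J] by blast
  have \<rho>: "additive \<rho>" "\<And>v. \<rho> v \<in> supported E" "\<And>v. v \<in> supported E \<Longrightarrow> \<rho> v = v"
    and \<pi>: "\<And>j. j \<in> J \<Longrightarrow> additive (\<pi> j)" "\<And>j v. j \<in> J \<Longrightarrow> \<pi> j v \<in> supported E"
      "\<And>j v. j \<in> J \<Longrightarrow> v \<in> supported E \<Longrightarrow> \<pi> j v = v"
    and \<sigma>: "\<And>j. j \<in> J \<Longrightarrow> additive (\<sigma> j)" "\<And>j v. j \<in> J \<Longrightarrow> \<sigma> j v \<in> supported Y"
      "\<And>j k v. j \<in> J \<Longrightarrow> k \<in> J \<Longrightarrow> v \<in> supported E \<Longrightarrow> \<pi> k (\<sigma> j v) = (if k = j then v else 0)"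
    using sc unfolding split_cover_def by blast+
  have "\<exists>h. \<forall>n\<in>N. additive (h n) \<and> (\<forall>v. h n v \<in> supported E) \<and> (\<forall>v\<in>Z n. h n v = f n v)"
    using h0 by (intro bchoice) blast
  then obtain h where h: "\<And>n. n \<in> N \<Longrightarrow> additive (h n)" "\<And>n v. n \<in> N \<Longrightarrow> h n v \<in> supported E"
      "\<And>n v. n \<in> N \<Longrightarrow> v \<in> Z n \<Longrightarrow> h n v = f n v"
    by blast
  have "\<exists>g. \<forall>n\<in>N. \<forall>j\<in>J. additive (g n j) \<and> (\<forall>v. g n j v \<in> supported E) \<and> (\<forall>v\<in>Z n. g n j v = f n v) \<and>
      (\<forall>v\<in>K j. g n j v \<in> K j)"
    using hK by (intro bchoice ballI) blast
  then obtain g where g: "\<And>n j. n \<in> N \<Longrightarrow> j \<in> J \<Longrightarrow> additive (g n j)"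
      "\<And>n j v. n \<in> N \<Longrightarrow> j \<in> J \<Longrightarrow> g n j v \<in> supported E"
      "\<And>n j v. n \<in> N \<Longrightarrow> j \<in> J \<Longrightarrow> v \<in> Z n \<Longrightarrow> g n j v = f n v"
      "\<And>n j v. n \<in> N \<Longrightarrow> j \<in> J \<Longrightarrow> v \<in> K j \<Longrightarrow> g n j v \<in> K j"
    by blast
  \<comment> \<open>The first summand alone would have the wrong coordinates; the copies correct each of them.\<close>
  define G where "G n v = h n (\<rho> v) + (\<Sum>j\<in>J. \<sigma> j (g n j (\<pi> j v) + h n (\<rho> v)))" for n v
  define M where "M j = {v \<in> supported Y. \<pi> j v \<in> K j}" for j
  \<comment> \<open>The operators of \<open>D\<close> are those that respect its coordinates; \<open>D0\<close> serves to say so before \<open>D\<close> is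
    defined.\<close>
  define D0 :: "('x, 'a) piece" where
    "D0 = \<lparr>atoms = Y, names = {}, act = (\<lambda>n v. 0), idx = J, val = \<gamma>, ker = M\<rparr>"
  define D :: "('x, 'a) piece" where
    "D = \<lparr>atoms = Y, names = N \<union> {(e, T) | T. preserves D0 T},
          act = (\<lambda>n. if fst n = e then snd n else G n), idx = J, val = \<gamma>, ker = M\<rparr>"
  have pres: "preserves D T \<longleftrightarrow> preserves D0 T" for T by (simp add: preserves_def D_def D0_def)
  have EY: "supported E \<subseteq> supported Y" using Y by (simp add: supported_mono)
  have \<pi>\<sigma>: "\<pi> k (\<Sum>j\<in>J. \<sigma> j (u j)) = u k" if "k \<in> J" "\<And>j. j \<in> J \<Longrightarrow> u j \<in> supported E" for u k
  proof -
    interpret additive "\<pi> k" using \<pi> that by blast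
    have "\<pi> k (\<Sum>j\<in>J. \<sigma> j (u j)) = (\<Sum>j\<in>J. \<pi> k (\<sigma> j (u j)))" by (rule sum)
    also have "\<dots> = (\<Sum>j\<in>J. if k = j then u j else 0)" using \<sigma>(3) that by (intro sum.cong) auto
    also have "\<dots> = u k" using J that by (simp add: sum.delta)
    finally show ?thesis .
  qed
  have gh: "g n j (\<pi> j v) + h n (\<rho> v) \<in> supported E" if "n \<in> N" "j \<in> J" for n j v
    using g(2) h(2) that lin_sub_add[OF lin_sub_supported] by blast
  have \<pi>G: "\<pi> k (G n v) = g n k (\<pi> k v)" if "n \<in> N" "k \<in> J" for n k v
  proof -
    interpret additive "\<pi> k" using \<pi> that by blast
    have "\<pi> k (G n v) = h n (\<rho> v) + (g n k (\<pi> k v) + h n (\<rho> v))"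
      unfolding G_def add using \<pi>(3)[OF that(2) h(2)[OF that(1)]] \<pi>\<sigma>[OF that(2) gh[OF that(1)]] by simp
    also have "\<dots> = g n k (\<pi> k v)" by (subst add.left_commute) simp
    finally show ?thesis .
  qed
  have lM: "lin_sub (M j)" if "j \<in> J" for j
  proof -
    interpret additive "\<pi> j" using \<pi> that by blast
    show ?thesis using K[OF that] lin_sub_supported[of Y] unfolding lin_sub_def M_def
      by (auto simp: zero add)
  qed
  have presG: "preserves D0 (G n)" if n: "n \<in> N" for n
    unfolding preserves_def
  proof (intro conjI ballI)
    interpret r: additive \<rho> by (rule \<rho>)
    interpret hh: additive "h n" using h n by blast
    have a: "additive (\<lambda>v. \<sigma> j (g n j (\<pi> j v) + h n (\<rho> v)))" if "j \<in> J" for j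
    proof -
      interpret s: additive "\<sigma> j" using \<sigma> that by blast
      interpret g: additive "g n j" using g n that by blast
      interpret p: additive "\<pi> j" using \<pi> that by blast
      show ?thesis by (simp add: additive_def s.add g.add p.add r.add hh.add ac_simps)
    qed
    show "additive (G n)"
      unfolding G_def by (intro additive_add additive_sum a additive_compose[OF hh.additive_axioms r.additive_axioms])
    have GY: "G n v \<in> supported Y" for v
      unfolding G_def using h(2)[OF n] EY \<sigma>(2) by (intro lin_sub_add[OF lin_sub_supported] lin_sub_sum[OF lin_sub_supported]) auto
    then show "G n v \<in> space D0" for v by (simp add: D0_def)
    fix j v assume "j \<in> idx D0" "v \<in> ker D0 j"
    then show "G n v \<in> ker D0 j"
      using GY \<pi>G[OF n] g(4)[OF n] by (auto simp: D0_def M_def)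
  qed
  have GZ: "G n v = f n v" if "n \<in> N" "v \<in> Z n" for n v
  proof -
    have v: "v \<in> supported E" using Z that by blast
    have "\<sigma> j (g n j (\<pi> j v) + h n (\<rho> v)) = 0" if "j \<in> J" for j
    proof -
      interpret s: additive "\<sigma> j" using \<sigma> that by blast
      show ?thesis using \<open>n \<in> N\<close> \<open>v \<in> Z n\<close> that v by (simp add: \<pi>(3) \<rho>(3) g(3) h(3) s.zero)
    qed
    then show ?thesis using that v by (simp add: G_def \<rho>(3) h(3))
  qed
  have MK: "v \<in> M j \<longleftrightarrow> v \<in> K j" if "j \<in> J" "v \<in> supported E" for j v
    using that \<pi>(3) EY by (auto simp: M_def)
  define \<epsilon> where "\<epsilon> j v = \<sigma> j (\<pi> j v)" for j v
  have "valid D"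
    unfolding valid_def
  proof (intro conjI ballI)
    show "finite (atoms D)" "finite (idx D)" using Y J by (auto simp: D_def)
    show "lin_sub (ker D j)" "ker D j \<subseteq> space D" if "j \<in> idx D" for j
      using lM that by (auto simp: D_def M_def)
    fix n assume "n \<in> names D"
    then consider "n \<in> N" | T where "n = (e, T)" "preserves D0 T" by (auto simp: D_def)
    then have "fst n \<in> atoms D \<and> preserves D (act D n)"
    proof cases
      case 1
      then show ?thesis using N[OF 1] presG[OF 1] Y unfolding pres by (auto simp: D_def)
    next
      case 2
      then show ?thesis using E Y unfolding pres by (auto simp: D_def)
    qed
    then show "fst n \<in> atoms D" "preserves D (act D n)" by auto
  qed
  moreover have "full D"
    unfolding full_def pres
  proof (intro allI impI)
    fix T assume "preserves D0 T"
    then show "\<exists>n\<in>names D. act D n = T" by (intro bexI[of _ "(e, T)"]) (auto simp: D_def)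
  qed
  moreover have "separated D \<epsilon>"
    unfolding separated_def
  proof (intro ballI conjI impI)
    fix j assume "j \<in> idx D"
    then have j: "j \<in> J" by (simp add: D_def)
    show "additive (\<epsilon> j)" unfolding \<epsilon>_def using additive_compose[OF \<sigma>(1)[OF j] \<pi>(1)[OF j]] .
    fix v assume v: "v \<in> space D"
    interpret p: additive "\<pi> j" using \<pi> j by blast
    show \<epsilon>: "\<epsilon> j v \<in> space D" using \<sigma>(2)[OF j] by (simp add: \<epsilon>_def D_def)
    have "\<pi> j (v + \<epsilon> j v) = 0" using \<sigma>(3)[OF j j \<pi>(2)[OF j]] by (simp add: p.add \<epsilon>_def)
    then show "v + \<epsilon> j v \<in> ker D j"
      using lin_sub_add[OF lin_sub_supported v \<epsilon>] lin_sub_0 K[OF j] by (auto simp: D_def M_def)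
    fix k assume "k \<in> idx D" and kj: "k \<noteq> j"
    then have k: "k \<in> J" by (simp add: D_def)
    have "\<pi> k (\<epsilon> j v) = 0" using \<sigma>(3)[OF j k \<pi>(2)[OF j]] kj by (simp add: \<epsilon>_def)
    then show "\<epsilon> j v \<in> ker D k" using \<epsilon> lin_sub_0 K[OF k] by (auto simp: D_def M_def)
  qed
  moreover have "act D n v = f n v" if "n \<in> N" "v \<in> Z n" for n v
    using that N[OF that(1)] GZ by (simp add: D_def)
  ultimately show ?thesis
    using Y MK by (intro exI[of _ D] exI[of _ \<epsilon>]) (auto simp: D_def)
qed


definition supp :: "('x, 'a) piece \<Rightarrow> 'x bvec \<Rightarrow> nat set" where
  "supp P v = {i \<in> idx P. v \<notin> ker P i}"

lemma below_iff_supp: "below P v d \<longleftrightarrow> (\<forall>i\<in>supp P v. val P i \<le> d)"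
  by (auto simp: below_def supp_def)

lemma supp_embedding:
  assumes "embedding P Q \<phi>" "v \<in> space P"
  shows "supp Q v = (\<Union>i\<in>supp P v. \<phi> i)"
  using assms unfolding embedding_def supp_def by blast

lemma separated_sum:
  assumes P: "valid P" and s: "separated P \<epsilon>" and A: "A \<subseteq> idx P" and u: "\<And>j. j \<in> A \<Longrightarrow> u j \<in> space P"
  shows "(\<Sum>j\<in>A. \<epsilon> j (u j)) \<in> space P"
    and "k \<in> A \<Longrightarrow> u k + (\<Sum>j\<in>A. \<epsilon> j (u j)) \<in> ker P k"
    and "k \<in> idx P - A \<Longrightarrow> (\<Sum>j\<in>A. \<epsilon> j (u j)) \<in> ker P k"
proof -
  have fA: "finite A" using P A unfolding valid_def by (meson finite_subset)
  have K: "lin_sub (ker P k)" if "k \<in> idx P" for k using P that by (simp add: valid_def)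
  show "(\<Sum>j\<in>A. \<epsilon> j (u j)) \<in> space P"
    using s A u by (intro lin_sub_sum lin_sub_supported) (auto simp: separated_def)
  show "(\<Sum>j\<in>A. \<epsilon> j (u j)) \<in> ker P k" if "k \<in> idx P - A"
  proof (rule lin_sub_sum)
    show "lin_sub (ker P k)" using K that by blast
    fix i assume "i \<in> A"
    then have "i \<in> idx P" "k \<in> idx P" "k \<noteq> i" "u i \<in> space P" using that A u by auto
    then show "\<epsilon> i (u i) \<in> ker P k" using s unfolding separated_def by blast
  qed
  show "u k + (\<Sum>j\<in>A. \<epsilon> j (u j)) \<in> ker P k" if k: "k \<in> A"
  proof -
    have "u k + (\<Sum>j\<in>A. \<epsilon> j (u j)) = (u k + \<epsilon> k (u k)) + (\<Sum>j\<in>A - {k}. \<epsilon> j (u j))"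
      using k fA by (simp add: sum.remove add.assoc)
    moreover have "u k + \<epsilon> k (u k) \<in> ker P k" using k s A u by (auto simp: separated_def)
    moreover have "(\<Sum>j\<in>A - {k}. \<epsilon> j (u j)) \<in> ker P k"
    proof (rule lin_sub_sum)
      show "lin_sub (ker P k)" using K k A by blast
      fix i assume "i \<in> A - {k}"
      then have "i \<in> idx P" "k \<in> idx P" "k \<noteq> i" "u i \<in> space P" using k A u by auto
      then show "\<epsilon> i (u i) \<in> ker P k" using s unfolding separated_def by blast
    qed
    ultimately show ?thesis using lin_sub_add[OF K] k A by (metis subsetD)
  qed
qed

text \<open>
  If the support of \<open>y\<close> is contained in that of \<open>x\<close>, some operator takes \<open>x\<close> to \<open>y\<close> up to a vector all
  of whose coordinates vanish: for each \<open>j\<close> in the support of \<open>y\<close>, read off a functional that detects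
  the \<open>j\<close>-th coordinate of \<open>x\<close> and put the \<open>j\<close>-th coordinate of \<open>y\<close> in its place.
\<close>

lemma full_separated_transitive:
  assumes P: "valid P" and "full P" and s: "separated P \<epsilon>"
    and x: "x \<in> space P" and y: "y \<in> space P" and xy: "supp P y \<subseteq> supp P x"
  shows "\<exists>n\<in>names P. below P (y + act P n x) d"
proof -
  let ?A = "supp P y"
  have A: "?A \<subseteq> idx P" by (auto simp: supp_def)
  have K: "lin_sub (ker P k)" if "k \<in> idx P" for k using P that by (simp add: valid_def)
  have "\<exists>S. additive S \<and> S x = y \<and> (\<forall>v\<in>ker P j. S v = 0) \<and> (\<forall>v. S v \<in> {0, y})" if "j \<in> ?A" for j
  proof -
    have "j \<in> idx P" "x \<notin> ker P j" using that xy by (auto simp: supp_def)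
    then show ?thesis using separating_additive[OF K, of j x y] by metis
  qed
  then obtain S where S: "\<And>j. j \<in> ?A \<Longrightarrow> additive (S j)" "\<And>j. j \<in> ?A \<Longrightarrow> S j x = y"
    "\<And>j v. j \<in> ?A \<Longrightarrow> v \<in> ker P j \<Longrightarrow> S j v = 0" "\<And>j v. j \<in> ?A \<Longrightarrow> S j v \<in> {0, y}"
    by metis
  have Sy: "S j v \<in> space P" if "j \<in> ?A" for j v
    using S(4)[OF that, of v] y lin_sub_0[OF lin_sub_supported, of "atoms P"] by auto
  define T where "T v = (\<Sum>j\<in>?A. \<epsilon> j (S j v))" for v
  have "preserves P T"
    unfolding preserves_def
  proof (intro conjI ballI)
    have "additive (\<epsilon> j)" if "j \<in> ?A" for j using s A that by (auto simp: separated_def)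
    then show "additive T" unfolding T_def using S(1) by (intro additive_sum) (simp add: additive_def)
    show "T v \<in> space P" for v
      unfolding T_def by (rule separated_sum[OF P s A Sy])
    fix k v assume k: "k \<in> idx P" and v: "v \<in> ker P k"
    show "T v \<in> ker P k"
    proof (cases "k \<in> ?A")
      case True
      then have "S k v + T v \<in> ker P k" unfolding T_def by (intro separated_sum(2)[OF P s A Sy])
      then show ?thesis using S(3)[OF True v] by simp
    next
      case False
      then show ?thesis unfolding T_def using k by (intro separated_sum(3)[OF P s A Sy]) auto
    qed
  qed
  then obtain n where n: "n \<in> names P" "act P n = T" using \<open>full P\<close> by (auto simp: full_def)
  have "y + T x \<in> ker P k" if k: "k \<in> idx P" for k
  proof (cases "k \<in> ?A")
    case True
    then have "S k x + T x \<in> ker P k" unfolding T_def by (intro separated_sum(2)[OF P s A Sy])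
    then show ?thesis using S(2)[OF True] by simp
  next
    case False
    then have "T x \<in> ker P k" unfolding T_def using k by (intro separated_sum(3)[OF P s A Sy]) auto
    moreover have "y \<in> ker P k" using False k by (auto simp: supp_def)
    ultimately show ?thesis using K[OF k] by (auto intro: lin_sub_add)
  qed
  then show ?thesis using n by (auto simp: below_def)
qed

lemma separated_splits:
  assumes P: "valid P" and s: "separated P \<epsilon>" and y: "y \<in> space P" and le: "supp P y \<subseteq> A \<union> B"
  shows "\<exists>y1\<in>space P. \<exists>y2\<in>space P. y = y1 + y2 \<and> supp P y1 \<subseteq> A \<and> supp P y2 \<subseteq> B"
proof -
  have K: "lin_sub (ker P k)" if "k \<in> idx P" for k using P that by (simp add: valid_def)
  let ?A = "supp P y \<inter> A"
  have A: "?A \<subseteq> idx P" by (auto simp: supp_def)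
  define z where "z = (\<Sum>j\<in>?A. \<epsilon> j y)"
  have z: "z \<in> space P" "\<And>k. k \<in> ?A \<Longrightarrow> y + z \<in> ker P k" "\<And>k. k \<in> idx P - ?A \<Longrightarrow> z \<in> ker P k"
    unfolding z_def using separated_sum[OF P s A, of "\<lambda>_. y"] y by blast+
  have "y = z + (y + z)" by (simp add: add.left_commute)
  moreover have "y + z \<in> space P" using y z by (intro lin_sub_add lin_sub_supported)
  moreover have "supp P z \<subseteq> A" using z(3) by (auto simp: supp_def)
  moreover have "supp P (y + z) \<subseteq> B"
  proof
    fix k assume k: "k \<in> supp P (y + z)"
    then have "k \<notin> ?A" using z(2) by (auto simp: supp_def)
    moreover have "y \<notin> ker P k"
      using k z(3)[of k] \<open>k \<notin> ?A\<close> lin_sub_add[OF K] by (auto simp: supp_def)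
    ultimately show "k \<in> B" using le k by (auto simp: supp_def)
  qed
  ultimately show ?thesis using z(1) by blast
qed

text \<open>
  If the coordinates are independent and nontrivial, every set of them is a support, so every supremum of values
  is the value of a vector.
\<close>

lemma separated_covers:
  assumes P: "valid P" and s: "separated P \<epsilon>" and A: "A \<subseteq> idx P" and proper: "\<And>j. j \<in> A \<Longrightarrow> \<not> space P \<subseteq> ker P j"
  shows "\<exists>w\<in>space P. supp P w = A"
proof -
  have K: "lin_sub (ker P k)" if "k \<in> idx P" for k using P that by (simp add: valid_def)
  obtain u where u: "\<And>j. j \<in> A \<Longrightarrow> u j \<in> space P" "\<And>j. j \<in> A \<Longrightarrow> u j \<notin> ker P j"
  proof -
    have "\<forall>j\<in>A. \<exists>u. u \<in> space P \<and> u \<notin> ker P j" using proper by blast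
    then have "\<exists>u. \<forall>j\<in>A. u j \<in> space P \<and> u j \<notin> ker P j" by (rule bchoice)
    then show thesis using that by blast
  qed
  let ?w = "\<Sum>j\<in>A. \<epsilon> j (u j)"
  have w: "?w \<in> space P" "\<And>k. k \<in> A \<Longrightarrow> u k + ?w \<in> ker P k" "\<And>k. k \<in> idx P - A \<Longrightarrow> ?w \<in> ker P k"
    using separated_sum[OF P s A, of u] u(1) by blast+
  have "?w \<notin> ker P k" if k: "k \<in> A" for k
  proof
    assume "?w \<in> ker P k"
    then have "(u k + ?w) + ?w \<in> ker P k" using lin_sub_add[OF K w(2)[OF k]] k A by blast
    then show False using u(2)[OF k] by (simp add: add.assoc)
  qed
  then have "supp P ?w = A" using w(3) A by (auto simp: supp_def)
  then show ?thesis using w(1) by blast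
qed

section \<open>Amalgamation of two pieces\<close>

text \<open>
  The two properties required of the final space, for vectors of \<open>P\<close> but with the operator and the
  summands taken from the larger piece \<open>Q\<close>. The operator takes \<open>x\<close> to \<open>y\<close> only up to a vector of value
  \<open>bot\<close>; such vectors are divided out later.
\<close>

definition solves :: "('x, 'a::order_bot) piece \<Rightarrow> ('x, 'a) piece \<Rightarrow> bool" where
  "solves P Q \<longleftrightarrow>
     (\<forall>x\<in>space P. \<forall>y\<in>space P. (\<forall>d. below P x d \<longrightarrow> below P y d) \<longrightarrow>
        (\<exists>n\<in>names Q. below Q (y + act Q n x) bot)) \<and>
     (\<forall>x1\<in>space P. \<forall>x2\<in>space P. \<forall>y\<in>space P.
        (\<forall>d. below P x1 d \<and> below P x2 d \<longrightarrow> below P y d) \<longrightarrow>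
        (\<exists>y1\<in>space Q. \<exists>y2\<in>space Q. y = y1 + y2 \<and>
           (\<forall>d. below Q x1 d \<longrightarrow> below Q y1 d) \<and> (\<forall>d. below Q x2 d \<longrightarrow> below Q y2 d)))"

definition covers :: "('x, 'a::order) piece \<Rightarrow> 'a \<Rightarrow> bool" where
  "covers P s \<longleftrightarrow> (\<exists>w\<in>space P. \<forall>d. below P w d \<longleftrightarrow> s \<le> d)"

lemma embedding_space: "embedding P Q \<phi> \<Longrightarrow> space P \<subseteq> space Q"
  by (simp add: embedding_def supported_mono)

text \<open>
  The index set of \<open>D\<close> comes from the Boolean refinement of the values of \<open>B\<close> and of \<open>C\<close> together with
  \<open>s\<close>. Since both images of an index of \<open>A\<close> have the same supremum, the refinement identifies them, and
  the two maps from \<open>A\<close> to \<open>D\<close> agree. The kernel of coordinate \<open>j\<close> of \<open>D\<close> is generated by the vectors of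
  \<open>B\<close> and of \<open>C\<close> that must lie in it. It meets \<open>B\<close> and \<open>C\<close> in nothing else, because both prescriptions
  agree on \<open>B \<inter> C\<close>. The refinement also turns inequalities between values of vectors of \<open>C\<close> into
  inclusions of supports in \<open>D\<close>, so that \<open>D\<close> solves the problems of \<open>C\<close>.
\<close>

lemma amalgamation:
  fixes A B C :: "('x, 'a::distributive_semilattice_sup_bot) piece"
  assumes A: "valid A" and B: "valid B" and C: "valid C" and AB: "embeds A B" and AC: "embeds A C"
    and atoms: "atoms B \<inter> atoms C \<subseteq> atoms A" and names: "names B \<inter> names C \<subseteq> names A"
    and F: "infinite F"
  shows "\<exists>D. valid D \<and> embeds B D \<and> embeds C D \<and> atoms D \<subseteq> atoms B \<union> atoms C \<union> F \<and>
     (\<forall>n\<in>names D. n \<in> names B \<or> n \<in> names C \<or> fst n \<in> F) \<and> solves C D \<and> covers D s"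
proof -
  obtain \<phi>1 \<phi>2 where \<phi>1: "embedding A B \<phi>1" and \<phi>2: "embedding A C \<phi>2"
    using AB AC unfolding embeds_def by blast
  \<comment> \<open>The third summand is for the additional value \<open>s\<close>.\<close>
  define I :: "(nat + nat + unit) set" where "I = Inl ` idx B \<union> Inr ` Inl ` idx C \<union> {Inr (Inr ())}"
  define \<beta> :: "nat + nat + unit \<Rightarrow> 'a" where "\<beta> = case_sum (val B) (case_sum (val C) (\<lambda>_. s))"
  have "finite I" using B C by (auto simp: I_def valid_def)
  from boolean_refinement[OF this, of \<beta>]
  obtain J :: "nat set" and \<gamma> \<phi> where J: "finite J" and \<phi>1': "\<forall>i\<in>I. \<phi> i \<subseteq> J \<and> is_lub (\<beta> i) (\<gamma> ` \<phi> i)"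
    and \<phi>2': "\<forall>a b. a \<subseteq> I \<longrightarrow> b \<subseteq> I \<longrightarrow> (\<forall>d. (\<forall>k\<in>b. \<beta> k \<le> d) \<longrightarrow> (\<forall>i\<in>a. \<beta> i \<le> d)) \<longrightarrow>
       (\<Union>i\<in>a. \<phi> i) \<subseteq> (\<Union>k\<in>b. \<phi> k)"
    by (elim exE conjE) (rule that)
  have \<phi>J: "\<phi> i \<subseteq> J" and lub: "is_lub (\<beta> i) (\<gamma> ` \<phi> i)" if "i \<in> I" for i using \<phi>1' that by auto
  have ref: "(\<Union>i\<in>a. \<phi> i) \<subseteq> (\<Union>k\<in>b. \<phi> k)"
    if "a \<subseteq> I" "b \<subseteq> I" "\<And>d. \<forall>k\<in>b. \<beta> k \<le> d \<Longrightarrow> \<forall>i\<in>a. \<beta> i \<le> d" for a b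
    using \<phi>2' that by meson
  define \<phi>B where "\<phi>B i = \<phi> (Inl i)" for i
  define \<phi>C where "\<phi>C i = \<phi> (Inr (Inl i))" for i
  have same: "(\<Union>i\<in>\<phi>1 k. \<phi>B i) = (\<Union>i\<in>\<phi>2 k. \<phi>C i)" if k: "k \<in> idx A" for k
  proof -
    let ?a = "Inl ` \<phi>1 k :: (nat + nat + unit) set" and ?b = "Inr ` Inl ` \<phi>2 k :: (nat + nat + unit) set"
    have "\<phi>1 k \<subseteq> idx B" "\<phi>2 k \<subseteq> idx C" using \<phi>1 \<phi>2 k by (auto simp: embedding_def)
    then have ab: "?a \<subseteq> I" "?b \<subseteq> I" unfolding I_def by blast+
    have a: "(\<forall>i\<in>?a. \<beta> i \<le> d) \<longleftrightarrow> val A k \<le> d" for d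
      using \<phi>1 k by (auto simp: embedding_def is_lub_def \<beta>_def)
    have b: "(\<forall>i\<in>?b. \<beta> i \<le> d) \<longleftrightarrow> val A k \<le> d" for d
      using \<phi>2 k by (auto simp: embedding_def is_lub_def \<beta>_def)
    have "(\<Union>i\<in>?a. \<phi> i) \<subseteq> (\<Union>k\<in>?b. \<phi> k)" by (rule ref[OF ab]) (simp only: a b)
    moreover have "(\<Union>i\<in>?b. \<phi> i) \<subseteq> (\<Union>k\<in>?a. \<phi> k)" by (rule ref[OF ab(2,1)]) (simp only: a b)
    ultimately show ?thesis by (auto simp: \<phi>B_def \<phi>C_def)
  qed
  define KB where "KB j = {v \<in> space B. \<forall>i\<in>idx B. j \<in> \<phi>B i \<longrightarrow> v \<in> ker B i}" for j
  define KC where "KC j = {v \<in> space C. \<forall>i\<in>idx C. j \<in> \<phi>C i \<longrightarrow> v \<in> ker C i}" for j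
  define K where "K j = {v + w | v w. v \<in> KB j \<and> w \<in> KC j}" for j
  have KB: "lin_sub (KB j)" "KB j \<subseteq> space B" for j
    using B lin_sub_supported[of "atoms B"] by (auto simp: KB_def valid_def lin_sub_def)
  have KC: "lin_sub (KC j)" "KC j \<subseteq> space C" for j
    using C lin_sub_supported[of "atoms C"] by (auto simp: KC_def valid_def lin_sub_def)
  have KBK: "KB j \<subseteq> K j" for j
  proof
    fix v assume "v \<in> KB j"
    moreover have "v = v + 0" by simp
    ultimately show "v \<in> K j" unfolding K_def using lin_sub_0[OF KC(1)] by blast
  qed
  have KCK: "KC j \<subseteq> K j" for j
  proof
    fix v assume "v \<in> KC j"
    moreover have "v = 0 + v" by simp
    ultimately show "v \<in> K j" unfolding K_def using lin_sub_0[OF KB(1)] by blast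
  qed
  have lK: "lin_sub (K j)" for j
    unfolding lin_sub_def
  proof (intro conjI ballI)
    show "0 \<in> K j" using KBK lin_sub_0[OF KB(1)] by blast
    fix v w assume "v \<in> K j" "w \<in> K j"
    then obtain a b a' b' where *: "v = a + b" "w = a' + b'" "a \<in> KB j" "b \<in> KC j" "a' \<in> KB j" "b' \<in> KC j"
      by (auto simp: K_def)
    have "v + w = (a + a') + (b + b')" using * by (simp add: ac_simps)
    then show "v + w \<in> K j" unfolding K_def using * lin_sub_add[OF KB(1)] lin_sub_add[OF KC(1)] by blast
  qed
  have BCA: "v \<in> space A" if "v \<in> space B" "v \<in> space C" for v
    using that atoms supported_Int supported_mono by blast
  have agree: "v \<in> KB j \<longleftrightarrow> v \<in> KC j" if v: "v \<in> space B" "v \<in> space C" for v j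
  proof -
    have "v \<in> KB j \<longleftrightarrow> (\<forall>i\<in>idx B. j \<in> \<phi>B i \<longrightarrow> (\<forall>k\<in>idx A. i \<in> \<phi>1 k \<longrightarrow> v \<in> ker A k))"
      using v \<phi>1 BCA[OF v] by (auto simp: KB_def embedding_def)
    also have "\<dots> \<longleftrightarrow> (\<forall>k\<in>idx A. j \<in> (\<Union>i\<in>\<phi>1 k. \<phi>B i) \<longrightarrow> v \<in> ker A k)"
      using \<phi>1 unfolding embedding_def by blast
    also have "\<dots> \<longleftrightarrow> (\<forall>k\<in>idx A. j \<in> (\<Union>i\<in>\<phi>2 k. \<phi>C i) \<longrightarrow> v \<in> ker A k)"
      using same by simp
    also have "\<dots> \<longleftrightarrow> (\<forall>i\<in>idx C. j \<in> \<phi>C i \<longrightarrow> (\<forall>k\<in>idx A. i \<in> \<phi>2 k \<longrightarrow> v \<in> ker A k))"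
      using \<phi>2 unfolding embedding_def by blast
    also have "\<dots> \<longleftrightarrow> v \<in> KC j"
      using v \<phi>2 BCA[OF v] by (auto simp: KC_def embedding_def)
    finally show ?thesis .
  qed
  have KKB: "v \<in> K j \<longleftrightarrow> v \<in> KB j" if v: "v \<in> space B" for v j
  proof
    assume "v \<in> K j"
    then obtain a b where ab: "v = a + b" "a \<in> KB j" "b \<in> KC j" by (auto simp: K_def)
    have "b = a + v" using ab by simp
    then have "b \<in> space B" using v ab KB(2) lin_sub_add[OF lin_sub_supported] by blast
    then have "b \<in> KB j" using agree ab KC(2) by blast
    then show "v \<in> KB j" using ab lin_sub_add[OF KB(1)] by blast
  qed (use KBK in blast)
  have KKC: "v \<in> K j \<longleftrightarrow> v \<in> KC j" if v: "v \<in> space C" for v j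
  proof
    assume "v \<in> K j"
    then obtain a b where ab: "v = a + b" "a \<in> KB j" "b \<in> KC j" by (auto simp: K_def)
    have "a = b + v" using ab by (simp add: add.left_commute)
    then have "a \<in> space C" using v ab KC(2) lin_sub_add[OF lin_sub_supported] by blast
    then have "a \<in> KC j" using agree ab KB(2) by blast
    then show "v \<in> KC j" using ab lin_sub_add[OF KC(1)] by blast
  qed (use KCK in blast)
  have finBC: "finite (atoms B \<union> atoms C)" using B C by (simp add: valid_def)
  then have "infinite (F - (atoms B \<union> atoms C))" using F by simp
  then obtain e where e: "e \<in> F" "e \<notin> atoms B" "e \<notin> atoms C"
    using not_finite_existsD by (metis Diff_iff UnI1 UnI2 ex_in_conv finite.emptyI)
  \<comment> \<open>The atom \<open>e\<close> yields a vector outside all kernels, which is needed to realise the value \<open>s\<close>.\<close>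
  define E where "E = atoms B \<union> atoms C \<union> {e}"
  have BE: "space B \<subseteq> supported E" and CE: "space C \<subseteq> supported E"
    by (auto simp: E_def intro!: supported_mono)
  have BCE: "space B \<subseteq> supported (atoms B \<union> atoms C)" "space C \<subseteq> supported (atoms B \<union> atoms C)"
    by (auto intro!: supported_mono)
  have KBC: "K j \<subseteq> supported (atoms B \<union> atoms C)" for j
    using KB(2) KC(2) BCE lin_sub_add[OF lin_sub_supported] unfolding K_def by blast
  have KE: "K j \<subseteq> supported E" for j
    using KBC supported_mono[of _ E] by (auto simp: E_def)
  define N where "N = names B \<union> names C"
  define Z where "Z n = (if n \<in> names B then space B else {}) \<union> (if n \<in> names C then space C else {})" for n
  define f where "f n v = (if n \<in> names B \<and> v \<in> space B then act B n v else act C n v)" for n v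
  have presB: "preserves B (act B n)" if "n \<in> names B" for n using B that by (simp add: valid_def)
  have presC: "preserves C (act C n)" if "n \<in> names C" for n using C that by (simp add: valid_def)
  have fg: "act B n v = act C n v"
    if "n \<in> names B" "n \<in> names C" "v \<in> space B" "v \<in> space C" for n v
  proof -
    have "n \<in> names A" "v \<in> space A" using names that BCA by blast+
    then show ?thesis using \<phi>1 \<phi>2 unfolding embedding_def by simp
  qed
  have ext: "\<exists>h. additive h \<and> (\<forall>v. h v \<in> supported E) \<and> (\<forall>v\<in>Z n. h v = f n v) \<and> (\<forall>v\<in>K j. h v \<in> K j)"
    if n: "n \<in> N" for n j
  proof -
    have PB: "act B n v \<in> KB j" if "n \<in> names B" "v \<in> KB j" for v
      using presB[OF that(1)] that(2) by (auto simp: preserves_def KB_def)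
    have PC: "act C n v \<in> KC j" if "n \<in> names C" "v \<in> KC j" for v
      using presC[OF that(1)] that(2) by (auto simp: preserves_def KC_def)
    have "\<exists>h. additive h \<and> (\<forall>v. h v \<in> supported E) \<and> (\<forall>v\<in>KB j. h v \<in> K j) \<and> (\<forall>v\<in>KC j. h v \<in> K j) \<and>
       (n \<in> names B \<longrightarrow> (\<forall>v\<in>space B. h v = act B n v)) \<and> (n \<in> names C \<longrightarrow> (\<forall>v\<in>space C. h v = act C n v))"
    proof (rule extend_operator[OF lin_sub_supported lin_sub_supported KB KC agree])
      show "lin_sub (supported E)" by (rule lin_sub_supported)
    qed (use presB presC PB PC fg BE CE lK KBK KCK in \<open>auto simp: preserves_def\<close>)
    then obtain h where h: "additive h" "\<And>v. h v \<in> supported E" "\<And>v. v \<in> KB j \<Longrightarrow> h v \<in> K j"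
      "\<And>v. v \<in> KC j \<Longrightarrow> h v \<in> K j" "\<And>v. n \<in> names B \<Longrightarrow> v \<in> space B \<Longrightarrow> h v = act B n v"
      "\<And>v. n \<in> names C \<Longrightarrow> v \<in> space C \<Longrightarrow> h v = act C n v"
      by blast
    have "h v \<in> K j" if vK: "v \<in> K j" for v
    proof -
      obtain a b where ab: "v = a + b" "a \<in> KB j" "b \<in> KC j" using vK unfolding K_def by blast
      show ?thesis using additive.add[OF h(1)] ab h(3,4) lin_sub_add[OF lK] by simp
    qed
    moreover have "h v = f n v" if "v \<in> Z n" for v
      using that h(5,6) by (auto simp: Z_def f_def split: if_splits)
    ultimately show ?thesis using h by blast
  qed
  have NE: "fst n \<in> E \<and> fst n \<noteq> e" if "n \<in> N" for n
    using that B C e by (auto simp: N_def valid_def E_def)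
  obtain D :: "('x, 'a) piece" and \<epsilon> where D: "valid D" "E \<subseteq> atoms D" "atoms D \<subseteq> E \<union> F" "idx D = J" "val D = \<gamma>"
     "N \<subseteq> names D" "fst ` (names D - N) \<subseteq> {e}" "\<forall>n\<in>N. \<forall>v\<in>Z n. act D n v = f n v"
     "\<forall>j\<in>J. \<forall>v\<in>supported E. v \<in> ker D j \<longleftrightarrow> v \<in> K j" "full D" "separated D \<epsilon>"
  proof -
    have "\<exists>(D :: ('x, 'a) piece) \<epsilon>. valid D \<and> E \<subseteq> atoms D \<and> atoms D \<subseteq> E \<union> F \<and> idx D = J \<and> val D = \<gamma> \<and>
     N \<subseteq> names D \<and> fst ` (names D - N) \<subseteq> {e} \<and> (\<forall>n\<in>N. \<forall>v\<in>Z n. act D n v = f n v) \<and>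
     (\<forall>j\<in>J. \<forall>v\<in>supported E. v \<in> ker D j \<longleftrightarrow> v \<in> K j) \<and> full D \<and> separated D \<epsilon>"
    proof (rule full_piece_exists[OF _ _ F J])
      show "finite E" "e \<in> E" using finBC by (auto simp: E_def)
      show "\<exists>h. additive h \<and> (\<forall>v. h v \<in> supported E) \<and> (\<forall>v\<in>Z n. h v = f n v)" if "n \<in> N" for n
        using ext[OF that] by blast
      show "Z n \<subseteq> supported E" for n using BE CE by (auto simp: Z_def)
    qed (use lK KE NE ext in blast)+
    then show thesis by (elim exE conjE) (rule that)
  qed
  have eB: "embedding B D \<phi>B"
    unfolding embedding_def
  proof (intro conjI ballI)
    show "atoms B \<subseteq> atoms D" using D(2) by (auto simp: E_def)
    show "names B \<subseteq> names D" using D(6) by (auto simp: N_def)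
    show "act D n v = act B n v" if "n \<in> names B" "v \<in> space B" for n v
      using D(8) that by (simp add: N_def Z_def f_def)
    fix i assume "i \<in> idx B"
    then have i: "Inl i \<in> I" by (simp add: I_def)
    show "\<phi>B i \<subseteq> idx D" using \<phi>J[OF i] D(4) by (simp add: \<phi>B_def)
    show "is_lub (val B i) (val D ` \<phi>B i)" using lub[OF i] D(5) by (simp add: \<phi>B_def \<beta>_def)
  next
    fix j v assume "j \<in> idx D" and v: "v \<in> space B"
    then have "v \<in> ker D j \<longleftrightarrow> v \<in> K j" using D(4,9) BE by blast
    then show "v \<in> ker D j \<longleftrightarrow> (\<forall>i\<in>idx B. j \<in> \<phi>B i \<longrightarrow> v \<in> ker B i)"
      using KKB[OF v] v by (simp add: KB_def)
  qed
  have eC: "embedding C D \<phi>C"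
    unfolding embedding_def
  proof (intro conjI ballI)
    show "atoms C \<subseteq> atoms D" using D(2) by (auto simp: E_def)
    show "names C \<subseteq> names D" using D(6) by (auto simp: N_def)
    show "act D n v = act C n v" if "n \<in> names C" "v \<in> space C" for n v
      using D(8) that fg by (simp add: N_def Z_def f_def)
    fix i assume "i \<in> idx C"
    then have i: "Inr (Inl i) \<in> I" by (simp add: I_def)
    show "\<phi>C i \<subseteq> idx D" using \<phi>J[OF i] D(4) by (simp add: \<phi>C_def)
    show "is_lub (val C i) (val D ` \<phi>C i)" using lub[OF i] D(5) by (simp add: \<phi>C_def \<beta>_def)
  next
    fix j v assume "j \<in> idx D" and v: "v \<in> space C"
    then have "v \<in> ker D j \<longleftrightarrow> v \<in> K j" using D(4,9) CE by blast
    then show "v \<in> ker D j \<longleftrightarrow> (\<forall>i\<in>idx C. j \<in> \<phi>C i \<longrightarrow> v \<in> ker C i)"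
      using KKC[OF v] v by (simp add: KC_def)
  qed
  have CD: "space C \<subseteq> space D" by (rule embedding_space[OF eC])
  have supp_le: "supp D y \<subseteq> (\<Union>x\<in>X. supp D x)"
    if y: "y \<in> space C" and X: "X \<subseteq> space C" and le: "\<And>d. \<forall>x\<in>X. below C x d \<Longrightarrow> below C y d" for y X
  proof -
    let ?a = "Inr ` Inl ` supp C y :: (nat + nat + unit) set" and ?b = "Inr ` Inl ` (\<Union>x\<in>X. supp C x) :: (nat + nat + unit) set"
    have "(\<Union>i\<in>?a. \<phi> i) \<subseteq> (\<Union>k\<in>?b. \<phi> k)"
    proof (rule ref)
      show "?a \<subseteq> I" "?b \<subseteq> I" by (auto simp: I_def supp_def)
      fix d assume "\<forall>k\<in>?b. \<beta> k \<le> d"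
      then have "\<forall>x\<in>X. below C x d" by (auto simp: below_iff_supp \<beta>_def)
      then have "below C y d" by (rule le)
      then show "\<forall>i\<in>?a. \<beta> i \<le> d" by (auto simp: below_iff_supp \<beta>_def)
    qed
    then have "(\<Union>i\<in>supp C y. \<phi>C i) \<subseteq> (\<Union>x\<in>X. \<Union>i\<in>supp C x. \<phi>C i)" by (auto simp: \<phi>C_def)
    moreover have *: "(\<Union>i\<in>supp C x. \<phi>C i) = supp D x" if "x \<in> space C" for x
      using supp_embedding[OF eC that] by simp
    moreover have "(\<Union>x\<in>X. \<Union>i\<in>supp C x. \<phi>C i) = (\<Union>x\<in>X. supp D x)"
      by (rule SUP_cong[OF refl *]) (use X in blast)
    ultimately show ?thesis using y by simp
  qed
  have mono: "below D y d" if "supp D y \<subseteq> supp D x" "below D x d" for x y d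
    using that by (auto simp: below_iff_supp)
  have "solves C D"
    unfolding solves_def
  proof (intro conjI ballI impI)
    fix x y assume xy: "x \<in> space C" "y \<in> space C" "\<forall>d. below C x d \<longrightarrow> below C y d"
    then have "supp D y \<subseteq> supp D x" using supp_le[of y "{x}"] by simp
    then show "\<exists>n\<in>names D. below D (y + act D n x) bot"
      using full_separated_transitive[OF D(1,10,11)] xy CD by blast
  next
    fix x1 x2 y assume xy: "x1 \<in> space C" "x2 \<in> space C" "y \<in> space C" "\<forall>d. below C x1 d \<and> below C x2 d \<longrightarrow> below C y d"
    then have "supp D y \<subseteq> supp D x1 \<union> supp D x2" using supp_le[of y "{x1, x2}"] by simp
    then have "\<exists>y1\<in>space D. \<exists>y2\<in>space D. y = y1 + y2 \<and> supp D y1 \<subseteq> supp D x1 \<and> supp D y2 \<subseteq> supp D x2"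
      using separated_splits[OF D(1,11)] xy CD by blast
    then show "\<exists>y1\<in>space D. \<exists>y2\<in>space D. y = y1 + y2 \<and>
        (\<forall>d. below D x1 d \<longrightarrow> below D y1 d) \<and> (\<forall>d. below D x2 d \<longrightarrow> below D y2 d)"
      using mono by blast
  qed
  moreover have "covers D s"
  proof -
    let ?s = "Inr (Inr ()) :: nat + nat + unit"
    have s: "?s \<in> I" by (simp add: I_def)
    define \<chi> :: "'x bvec" where "\<chi> x = (if x = e then 1 else 0)" for x
    have \<chi>: "\<chi> \<in> supported E" by (simp add: \<chi>_def supported_def E_def)
    have "\<chi> e \<noteq> 0" by (simp add: \<chi>_def)
    then have "\<chi> \<notin> supported (atoms B \<union> atoms C)" using e unfolding supported_def by blast
    then have "\<chi> \<notin> ker D j" if "j \<in> idx D" for j using D(4,9) \<chi> KBC that by blast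
    moreover have "\<chi> \<in> space D" using \<chi> D(2) supported_mono by blast
    ultimately have "\<exists>w\<in>space D. supp D w = \<phi> ?s"
      using \<phi>J[OF s] D(4) by (intro separated_covers[OF D(1,11)]) auto
    then obtain w where w: "w \<in> space D" "supp D w = \<phi> ?s" by blast
    then have "below D w d \<longleftrightarrow> s \<le> d" for d
      unfolding below_iff_supp using lub[OF s] D(5) by (simp add: is_lub_def \<beta>_def)
    then show ?thesis using w(1) unfolding covers_def by blast
  qed
  moreover have "atoms D \<subseteq> atoms B \<union> atoms C \<union> F" using D(3) e by (auto simp: E_def)
  moreover have "n \<in> names B \<or> n \<in> names C \<or> fst n \<in> F" if "n \<in> names D" for n
    using D(7) that e(1) by (auto simp: N_def)
  ultimately show ?thesis using D(1) eB eC unfolding embeds_def by blast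
qed

section \<open>Directed systems of pieces\<close>

definition empty_piece :: "('x, 'a::order_bot) piece" where
  "empty_piece = \<lparr>atoms = {}, names = {}, act = (\<lambda>n v. 0), idx = {}, val = (\<lambda>_. bot), ker = (\<lambda>_. {})\<rparr>"

lemma valid_empty_piece: "valid empty_piece"
  by (simp add: valid_def empty_piece_def)

lemma embeds_empty_piece:
  fixes P :: "('x, 'a::order_bot) piece"
  assumes "valid P" shows "embeds empty_piece P"
proof -
  have "space (empty_piece :: ('x, 'a) piece) = {0}" by (auto simp: supported_def empty_piece_def)
  moreover have "0 \<in> ker P j" if "j \<in> idx P" for j using assms that lin_sub_0 by (auto simp: valid_def)
  ultimately have "embedding empty_piece P (\<lambda>_. {})"
    unfolding embedding_def by (auto simp: empty_piece_def)
  then show ?thesis unfolding embeds_def by blast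
qed

definition directed_system :: "('x, 'a::order_bot) piece set \<Rightarrow> bool" where
  "directed_system \<P> \<longleftrightarrow> empty_piece \<in> \<P> \<and> (\<forall>P\<in>\<P>. valid P) \<and>
     (\<forall>P\<in>\<P>. \<forall>Q\<in>\<P>. \<exists>R\<in>\<P>. embeds P R \<and> embeds Q R)"

lemma embeds_solves:
  assumes "embeds P Q" "solves Q R"
  shows "solves P R"
proof -
  obtain \<phi> where \<phi>: "embedding P Q \<phi>" using assms(1) unfolding embeds_def by blast
  have sub: "space P \<subseteq> space Q" by (rule embedding_space[OF \<phi>])
  have b: "below P v d \<longleftrightarrow> below Q v d" if "v \<in> space P" for v d using below_embedding[OF \<phi> that] by simp
  show ?thesis
    using assms(2) sub unfolding solves_def by (simp add: b subset_iff)
qed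

text \<open>
  The chain starts with the empty piece, over which the ladder in \<open>extend_countable_system\<close> begins.
\<close>

lemma cofinal_chain:
  assumes D: "directed_system \<P>" and c: "countable \<P>"
  shows "\<exists>P. P 0 = empty_piece \<and> (\<forall>n. P n \<in> \<P> \<and> embeds (P n) (P (Suc n))) \<and> (\<forall>Q\<in>\<P>. \<exists>n. embeds Q (P (Suc n)))"
proof -
  have ne: "\<P> \<noteq> {}" using D by (auto simp: directed_system_def)
  let ?e = "from_nat_into \<P>"
  have "\<exists>P. \<forall>n. (P n \<in> \<P> \<and> (n = 0 \<longrightarrow> P n = empty_piece)) \<and> (embeds (P n) (P (Suc n)) \<and> embeds (?e n) (P (Suc n)))"
  proof (rule dependent_nat_choice)
    show "\<exists>P. P \<in> \<P> \<and> (0 = (0::nat) \<longrightarrow> P = empty_piece)" using D by (auto simp: directed_system_def)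
    fix P and n :: nat assume "P \<in> \<P> \<and> (n = 0 \<longrightarrow> P = empty_piece)"
    then show "\<exists>Q. (Q \<in> \<P> \<and> (Suc n = 0 \<longrightarrow> Q = empty_piece)) \<and> embeds P Q \<and> embeds (?e n) Q"
      using D from_nat_into[OF ne, of n] unfolding directed_system_def by blast
  qed
  then obtain P where P: "\<And>n. P n \<in> \<P>" "P 0 = empty_piece" "\<And>n. embeds (P n) (P (Suc n))" "\<And>n. embeds (?e n) (P (Suc n))"
    by metis
  have "\<exists>n. embeds Q (P (Suc n))" if "Q \<in> \<P>" for Q
  proof -
    obtain n where "Q = ?e n" using from_nat_into_surj[OF c \<open>Q \<in> \<P>\<close>] by metis
    then show ?thesis using P(4) by blast
  qed
  then show ?thesis using P(1-3) by blast
qed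

lemma embeds_chain:
  assumes "\<And>n. embeds (P n) (P (Suc n))" "m \<le> n"
  shows "embeds (P m) (P n)"
  using assms(2) by (rule transitive_stepwise_le) (use embeds_refl embeds_trans assms(1) in blast)+

lemma embeds_atoms: "embeds P Q \<Longrightarrow> atoms P \<subseteq> atoms Q"
  and embeds_names: "embeds P Q \<Longrightarrow> names P \<subseteq> names Q"
  by (auto simp: embeds_def embedding_def)

text \<open>
  Along a cofinal chain \<open>P\<close> a chain \<open>Q\<close> is built in which each member is the amalgam of the previous one
  with the next member of \<open>P\<close>. Each step glues just two pieces over a common subpiece. The enlarged
  system is directed because each piece of the old system lies in some \<open>P n\<close> and hence in \<open>Q n\<close>.
\<close>

lemma extend_countable_system:
  fixes \<P> :: "('x, 'a::distributive_semilattice_sup_bot) piece set"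
  assumes D: "directed_system \<P>" and c: "countable \<P>" and F: "infinite F" "F \<inter> (\<Union>P\<in>\<P>. atoms P) = {}"
  shows "\<exists>\<Q>. directed_system \<Q> \<and> countable \<Q> \<and> \<P> \<subseteq> \<Q> \<and> (\<Union>Q\<in>\<Q>. atoms Q) \<subseteq> (\<Union>P\<in>\<P>. atoms P) \<union> F \<and>
     (\<forall>P\<in>\<P>. \<exists>Q\<in>\<Q>. embeds P Q \<and> solves P Q) \<and> (\<exists>Q\<in>\<Q>. covers Q s)"
proof -
  define Old where "Old = (\<Union>P\<in>\<P>. atoms P)"
  have FO: "F \<inter> Old = {}" using F(2) by (simp add: Old_def)
  obtain P where P0: "P 0 = empty_piece" and P\<P>: "\<And>n. P n \<in> \<P>" and PS: "\<And>n. embeds (P n) (P (Suc n))"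
    and cof: "\<And>Q. Q \<in> \<P> \<Longrightarrow> \<exists>n. embeds Q (P (Suc n))"
    using cofinal_chain[OF D c] by metis
  have vP: "valid (P n)" for n using D P\<P> by (auto simp: directed_system_def)
  have PO: "atoms (P n) \<subseteq> Old" for n using P\<P> by (auto simp: Old_def)
  \<comment> \<open>The last two conditions keep \<open>Q n\<close> apart from the pieces of the old system, except for \<open>P n\<close>.
    They ensure that \<open>Q n\<close> and \<open>P (Suc n)\<close> have only \<open>P n\<close> in common.\<close>
  define tracks where "tracks n Q \<longleftrightarrow> valid Q \<and> embeds (P n) Q \<and> atoms Q \<subseteq> Old \<union> F \<and> atoms Q \<inter> Old \<subseteq> atoms (P n) \<and>
      (\<forall>m\<in>names Q. fst m \<in> Old \<longrightarrow> m \<in> names (P n))" for n Q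
  have "\<exists>Q. \<forall>n. tracks n (Q n) \<and> (embeds (Q n) (Q (Suc n)) \<and> solves (P (Suc n)) (Q (Suc n)) \<and> covers (Q (Suc n)) s)"
  proof (rule dependent_nat_choice)
    show "\<exists>Q. tracks 0 Q"
      by (rule exI[of _ empty_piece])
        (simp add: tracks_def P0 valid_empty_piece embeds_empty_piece, simp add: empty_piece_def)
    fix Q n assume Q: "tracks n Q"
    then have tQ: "valid Q" "embeds (P n) Q" "atoms Q \<subseteq> Old \<union> F" "atoms Q \<inter> Old \<subseteq> atoms (P n)"
      "\<And>m. m \<in> names Q \<Longrightarrow> fst m \<in> Old \<Longrightarrow> m \<in> names (P n)"
      by (simp_all add: tracks_def)
    have "atoms Q \<inter> atoms (P (Suc n)) \<subseteq> atoms (P n)" using tQ(4) PO[of "Suc n"] by blast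
    moreover have "names Q \<inter> names (P (Suc n)) \<subseteq> names (P n)"
    proof
      fix m assume m: "m \<in> names Q \<inter> names (P (Suc n))"
      then have "fst m \<in> Old" using vP[of "Suc n"] PO[of "Suc n"] by (auto simp: valid_def)
      then show "m \<in> names (P n)" using tQ(5) m by blast
    qed
    ultimately obtain R where R: "valid R" "embeds Q R" "embeds (P (Suc n)) R"
      "atoms R \<subseteq> atoms Q \<union> atoms (P (Suc n)) \<union> F" "\<forall>m\<in>names R. m \<in> names Q \<or> m \<in> names (P (Suc n)) \<or> fst m \<in> F"
      "solves (P (Suc n)) R" "covers R s"
      using amalgamation[OF vP[of n] _ vP[of "Suc n"] _ PS[of n] _ _ F(1), of Q s] tQ(1,2) by blast
    have "tracks (Suc n) R"
      unfolding tracks_def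
    proof (intro conjI ballI impI R)
      have PP: "atoms (P n) \<subseteq> atoms (P (Suc n))" "names (P n) \<subseteq> names (P (Suc n))"
        using embeds_atoms[OF PS] embeds_names[OF PS] by blast+
      show "atoms R \<subseteq> Old \<union> F" using R(4) tQ(3) PO[of "Suc n"] by blast
      show "atoms R \<inter> Old \<subseteq> atoms (P (Suc n))" using R(4) tQ(4) PP FO by blast
      fix m assume "m \<in> names R" "fst m \<in> Old"
      then show "m \<in> names (P (Suc n))" using R(5) tQ(5) PP FO by blast
    qed
    then show "\<exists>R. tracks (Suc n) R \<and> embeds Q R \<and> solves (P (Suc n)) R \<and> covers R s" using R by blast
  qed
  then obtain Q where Q: "\<And>n. tracks n (Q n)" "\<And>n. embeds (Q n) (Q (Suc n))" "\<And>n. solves (P (Suc n)) (Q (Suc n))"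
     "\<And>n. covers (Q (Suc n)) s"
    by metis
  have PQ: "embeds (P n) (Q n)" for n using Q(1) by (simp add: tracks_def)
  have Qmono: "embeds (Q m) (Q n)" if "m \<le> n" for m n by (rule embeds_chain[of Q, OF Q(2) that])
  have toQ: "\<exists>n. embeds R (Q n)" if "R \<in> \<P> \<union> range Q" for R
    using that cof PQ embeds_trans embeds_refl by blast
  have "directed_system (\<P> \<union> range Q)"
    unfolding directed_system_def
  proof (intro conjI ballI)
    show "empty_piece \<in> \<P> \<union> range Q" using D by (simp add: directed_system_def)
    show "valid R" if "R \<in> \<P> \<union> range Q" for R
      using that D Q(1) by (auto simp: directed_system_def tracks_def)
    fix R R' assume "R \<in> \<P> \<union> range Q" "R' \<in> \<P> \<union> range Q"
    then obtain m n where "embeds R (Q m)" "embeds R' (Q n)" using toQ by blast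
    then have "embeds R (Q (max m n))" "embeds R' (Q (max m n))"
      using Qmono[of m "max m n"] Qmono[of n "max m n"] embeds_trans by auto
    then show "\<exists>S\<in>\<P> \<union> range Q. embeds R S \<and> embeds R' S" by blast
  qed
  moreover have "countable (\<P> \<union> range Q)" using c by simp
  moreover have "(\<Union>R\<in>\<P> \<union> range Q. atoms R) \<subseteq> Old \<union> F" 
  proof -
    have "atoms (Q n) \<subseteq> Old \<union> F" for n using Q(1) by (simp add: tracks_def)
    moreover have "atoms R \<subseteq> Old" if "R \<in> \<P>" for R using that by (auto simp: Old_def)
    ultimately show ?thesis by blast
  qed
  moreover have "\<exists>R\<in>\<P> \<union> range Q. embeds S R \<and> solves S R" if "S \<in> \<P>" for S
  proof -
    obtain n where n: "embeds S (P (Suc n))" using cof \<open>S \<in> \<P>\<close> by blast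
    then have "embeds S (Q (Suc n))" "solves S (Q (Suc n))"
      using PQ embeds_trans embeds_solves Q(3) by blast+
    then show ?thesis by blast
  qed
  moreover have "\<exists>R\<in>\<P> \<union> range Q. covers R s" using Q(4) by blast
  ultimately show ?thesis by (intro exI[of _ "\<P> \<union> range Q"]) (simp add: Old_def)
qed

text \<open>
  The type \<open>'x\<close> serves both as the set of atoms and as the index set of the transfinite recursion.
  Ordered in type at most \<open>\<omega>\<^sub>1\<close>, it has countable initial segments, so that every union of earlier
  systems is countable and can be enlarged. Stage \<open>x\<close> uses the atoms of its own infinite set \<open>F x\<close> and
  brings in the value \<open>t x\<close>. There is no last stage, so every piece is solved at some later stage.
\<close>

lemma directed_system_exists:
  fixes t :: "'x \<Rightarrow> 'a::distributive_semilattice_sup_bot"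
  assumes inf: "infinite (UNIV :: 'x set)" and small: "|UNIV :: 'x set| \<le>o cardSuc natLeq"
  shows "\<exists>\<P> :: ('x, 'a) piece set. directed_system \<P> \<and> (\<forall>P\<in>\<P>. \<exists>Q\<in>\<P>. embeds P Q \<and> solves P Q) \<and>
     (\<forall>x. \<exists>Q\<in>\<P>. covers Q (t x))"
proof -
  let ?r = "|UNIV :: 'x set|"
  have wo: "Well_order ?r" and fld: "Field ?r = UNIV" by (rule card_of_Well_order) (rule Field_card_of)
  have cnt: "countable (underS ?r x)" for x
  proof -
    have "|underS ?r x| <o ?r" by (rule card_of_underS[OF card_of_Card_order]) (simp only: fld UNIV_I)
    then have "|underS ?r x| <o cardSuc natLeq" using small by (rule ordLess_ordLeq_trans)
    then have "|underS ?r x| \<le>o natLeq"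
      using cardSuc_ordLeq_ordLess[OF natLeq_Card_order card_of_Card_order] by blast
    then have "|underS ?r x| \<le>o |UNIV :: nat set|"
      by (rule ordLeq_ordIso_trans[OF _ ordIso_symmetric[OF card_of_nat]])
    then show ?thesis by (metis card_of_ordLeq countableI)
  qed
  define lt where "lt = ?r - Id"
  have wf: "wf lt" unfolding lt_def using wo by (simp add: well_order_on_def)
  have trans: "(x, z) \<in> lt" if "(x, y) \<in> lt" "(y, z) \<in> lt" for x y z
    using wo that unfolding lt_def order_on_defs trans_def antisym_def by blast
  have total: "(x, y) \<in> lt \<or> x = y \<or> (y, x) \<in> lt" for x y
    using wo fld unfolding lt_def order_on_defs total_on_def by auto
  have cnt': "countable {y. (y, x) \<in> lt}" for x
    using cnt[of x] by (rule countable_subset[rotated]) (auto simp: lt_def underS_def)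
  have succ: "\<exists>y. (x, y) \<in> lt" for x
    using infinite_Card_order_limit[OF card_of_Card_order, of "UNIV :: 'x set" x] inf fld by (auto simp: lt_def)
  have "|(UNIV :: 'x set) \<times> (UNIV :: nat set)| =o |UNIV :: 'x set|"
    using card_of_Times_infinite[OF inf, of "UNIV :: nat set"] infinite_iff_card_of_nat inf by auto
  then obtain c :: "'x \<times> nat \<Rightarrow> 'x" where c: "inj c"
    using card_of_ordIso[of "(UNIV :: 'x set) \<times> (UNIV :: nat set)" "UNIV :: 'x set"] by (auto simp: bij_betw_def)
  define F where "F x = c ` ({x} \<times> UNIV)" for x
  have Finf: "infinite (F x)" for x
    unfolding F_def by (subst finite_image_iff) (auto intro: inj_on_subset[OF c] simp: finite_cartesian_product_iff)
  have Fdisj: "F x \<inter> F y = {}" if "x \<noteq> y" for x y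
    using that c by (auto simp: F_def inj_def)
  define prev where "prev f x = insert (empty_piece :: ('x, 'a) piece) (\<Union>y\<in>{y. (y, x) \<in> lt}. f y)" for f x
  define H where "H x = (\<Union>z\<in>{z. (z, x) \<in> lt}. F z)" for x
  have H: "H y \<union> F y \<subseteq> H x" if "(y, x) \<in> lt" for x y using that trans[OF _ that] unfolding H_def by blast
  define good where "good f x \<Q> \<longleftrightarrow> directed_system \<Q> \<and> countable \<Q> \<and> prev f x \<subseteq> \<Q> \<and>
     (\<Union>Q\<in>\<Q>. atoms Q) \<subseteq> H x \<union> F x \<and>
     (\<forall>P\<in>prev f x. \<exists>Q\<in>\<Q>. embeds P Q \<and> solves P Q) \<and> (\<exists>Q\<in>\<Q>. covers Q (t x))" for f x \<Q>
  have "\<exists>f. \<forall>x. good f x (f x)"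
  proof (rule dependent_wf_choice[OF wf])
    fix f g :: "'x \<Rightarrow> ('x, 'a) piece set" and x \<Q>
    assume "\<And>z. (z, x) \<in> lt \<Longrightarrow> f z = g z"
    then have "prev f x = prev g x" by (auto simp: prev_def)
    then show "good f x \<Q> = good g x \<Q>" by (simp add: good_def)
  next
    fix x f assume IH: "\<And>y. (y, x) \<in> lt \<Longrightarrow> good f y (f y)"
    have mono: "f z \<subseteq> f y" if "(z, y) \<in> lt" "(y, x) \<in> lt" for y z
      using IH[OF that(2)] that(1) by (auto simp: good_def prev_def)
    have prevH: "(\<Union>P\<in>prev f x. atoms P) \<subseteq> H x"
    proof (rule UN_least)
      fix P assume "P \<in> prev f x"
      then consider "P = empty_piece" | y where "(y, x) \<in> lt" "P \<in> f y" by (auto simp: prev_def)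
      then show "atoms P \<subseteq> H x"
      proof cases
        case 1
        then show ?thesis by (simp add: empty_piece_def)
      next
        case 2
        then have "atoms P \<subseteq> H y \<union> F y" using IH[OF 2(1)] unfolding good_def by blast
        then show ?thesis using H[OF 2(1)] by blast
      qed
    qed
    have "directed_system (prev f x)"
      unfolding directed_system_def
    proof (intro conjI ballI)
      show "empty_piece \<in> prev f x" by (simp add: prev_def)
      show v: "valid P" if "P \<in> prev f x" for P
        using that IH valid_empty_piece by (auto simp: prev_def good_def directed_system_def)
      fix P Q assume PQ: "P \<in> prev f x" "Q \<in> prev f x"
      show "\<exists>R\<in>prev f x. embeds P R \<and> embeds Q R"
      proof (cases "P = empty_piece \<or> Q = empty_piece")
        case True
        then show ?thesis using PQ v embeds_empty_piece embeds_refl by blast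
      next
        case False
        then obtain y z where yz: "(y, x) \<in> lt" "P \<in> f y" "(z, x) \<in> lt" "Q \<in> f z" using PQ by (auto simp: prev_def)
        have "\<exists>w. (w, x) \<in> lt \<and> P \<in> f w \<and> Q \<in> f w"
          using total[of y z] mono yz by blast
        then obtain w where w: "(w, x) \<in> lt" "P \<in> f w" "Q \<in> f w" by blast
        then have "\<exists>R\<in>f w. embeds P R \<and> embeds Q R" using IH[OF w(1)] by (simp add: good_def directed_system_def)
        then show ?thesis using w(1) by (auto simp: prev_def)
      qed
    qed
    moreover have "countable (prev f x)"
      unfolding prev_def using cnt'[of x] IH by (intro countable_insert countable_UN) (auto simp: good_def)
    moreover have "F x \<inter> (\<Union>P\<in>prev f x. atoms P) = {}"
    proof -
      have "F x \<inter> F z = {}" if "(z, x) \<in> lt" for z using that by (intro Fdisj) (auto simp: lt_def)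
      then have "F x \<inter> H x = {}" by (auto simp: H_def)
      then show ?thesis using prevH by blast
    qed
    ultimately obtain \<Q> where \<Q>: "directed_system \<Q>" "countable \<Q>" "prev f x \<subseteq> \<Q>"
      "(\<Union>Q\<in>\<Q>. atoms Q) \<subseteq> (\<Union>P\<in>prev f x. atoms P) \<union> F x"
      "\<forall>P\<in>prev f x. \<exists>Q\<in>\<Q>. embeds P Q \<and> solves P Q" "\<exists>Q\<in>\<Q>. covers Q (t x)"
      using extend_countable_system[OF _ _ Finf[of x], of "prev f x" "t x"] by blast
    have "(\<Union>Q\<in>\<Q>. atoms Q) \<subseteq> H x \<union> F x" using \<Q>(4) prevH by blast
    then show "\<exists>\<Q>. good f x \<Q>" unfolding good_def using \<Q> by blast
  qed
  then obtain f where f: "\<And>x. good f x (f x)" by blast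
  have mono: "f z \<subseteq> f y" if "(z, y) \<in> lt" for y z using f[of y] that by (auto simp: good_def prev_def)
  let ?P = "\<Union>x. f x"
  have "directed_system ?P"
    unfolding directed_system_def
  proof (intro conjI ballI)
    show "empty_piece \<in> ?P" using f by (auto simp: good_def prev_def)
    show "valid P" if "P \<in> ?P" for P using that f by (auto simp: good_def directed_system_def)
    fix P Q assume "P \<in> ?P" "Q \<in> ?P"
    then obtain y z where yz: "P \<in> f y" "Q \<in> f z" by blast
    then have "\<exists>w. P \<in> f w \<and> Q \<in> f w" using total[of y z] mono by blast
    then obtain w where w: "P \<in> f w" "Q \<in> f w" by blast
    then have "\<exists>R\<in>f w. embeds P R \<and> embeds Q R" using f[of w] by (simp add: good_def directed_system_def)
    then show "\<exists>R\<in>?P. embeds P R \<and> embeds Q R" by blast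
  qed
  moreover have "\<exists>Q\<in>?P. embeds P Q \<and> solves P Q" if "P \<in> ?P" for P
  proof -
    obtain x where "P \<in> f x" using \<open>P \<in> ?P\<close> by blast
    moreover obtain y where "(x, y) \<in> lt" using succ by blast
    ultimately have "P \<in> prev f y" by (auto simp: prev_def)
    then show ?thesis using f[of y] unfolding good_def by blast
  qed
  moreover have "\<exists>Q\<in>?P. covers Q (t x)" for x using f[of x] unfolding good_def by blast
  ultimately show ?thesis by blast
qed

section \<open>The valued vector space of a directed system\<close>

text \<open>
  The properties of a valued vector space \<open>W\<close> from which its submodules over the ring of all additive
  maps that do not increase \<open>\<Phi>\<close> can be read off.
\<close>

definition module_valuation :: "'x bvec set \<Rightarrow> ('x bvec \<Rightarrow> 'a::bounded_semilattice_sup_bot) \<Rightarrow> bool" where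
  "module_valuation W \<Phi> \<longleftrightarrow> lin_sub W \<and>
     (\<forall>v\<in>W. \<Phi> v = bot \<longleftrightarrow> v = 0) \<and>
     (\<forall>v\<in>W. \<forall>w\<in>W. \<Phi> (v + w) \<le> sup (\<Phi> v) (\<Phi> w)) \<and>
     (\<forall>a. \<exists>w\<in>W. \<Phi> w = a) \<and>
     (\<forall>x\<in>W. \<forall>y\<in>W. \<Phi> y \<le> \<Phi> x \<longrightarrow>
        (\<exists>f. additive f \<and> (\<forall>w\<in>W. f w \<in> W \<and> \<Phi> (f w) \<le> \<Phi> w) \<and> f x = y)) \<and>
     (\<forall>y\<in>W. \<forall>a b. \<Phi> y \<le> sup a b \<longrightarrow>
        (\<exists>y1\<in>W. \<exists>y2\<in>W. y = y1 + y2 \<and> \<Phi> y1 \<le> a \<and> \<Phi> y2 \<le> b))"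

lemma directed_system_upper_bound:
  assumes D: "directed_system \<P>" and "finite \<F>" "\<F> \<subseteq> \<P>"
  shows "\<exists>R\<in>\<P>. \<forall>P\<in>\<F>. embeds P R"
  using assms(2,3)
proof induction
  case empty
  then show ?case using D by (auto simp: directed_system_def)
next
  case (insert P \<F>)
  then obtain R where R: "R \<in> \<P>" "\<forall>P\<in>\<F>. embeds P R" by auto
  then obtain S where "S \<in> \<P>" "embeds P S" "embeds R S"
    using D insert.prems unfolding directed_system_def by blast
  then show ?case using R embeds_trans by blast
qed

lemma embeds_space: "embeds P Q \<Longrightarrow> space P \<subseteq> space Q"
  by (rule supported_mono) (rule embeds_atoms)

lemma embeds_act: "embeds P Q \<Longrightarrow> n \<in> names P \<Longrightarrow> v \<in> space P \<Longrightarrow> act Q n v = act P n v"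
  by (auto simp: embeds_def embedding_def)

lemma embeds_below: "embeds P Q \<Longrightarrow> v \<in> space P \<Longrightarrow> below Q v d \<longleftrightarrow> below P v d"
  unfolding embeds_def using below_embedding by blast

text \<open>
  On the union \<open>U\<close> of all pieces, values and operators are inherited from any piece that is large
  enough. The vectors of value \<open>bot\<close> form a subspace \<open>N0\<close>. Instead of the quotient a complement \<open>W\<close> of
  \<open>N0\<close> is used, with the projection \<open>p\<close> of \<open>U\<close> onto \<open>W\<close>. It changes vectors only by elements of \<open>N0\<close> and
  so preserves values; operators are followed by \<open>p\<close>.
\<close>

lemma module_valuation_exists:
  fixes \<P> :: "('x, 'a::bounded_semilattice_sup_bot) piece set"
  assumes D: "directed_system \<P>" and solved: "\<And>P. P \<in> \<P> \<Longrightarrow> \<exists>Q\<in>\<P>. embeds P Q \<and> solves P Q"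
    and covered: "\<And>a. \<exists>Q\<in>\<P>. covers Q a"
  shows "\<exists>W \<Phi> :: 'x bvec \<Rightarrow> 'a. module_valuation W \<Phi>"
proof -
  define U where "U = (\<Union>P\<in>\<P>. space P)"
  have valid: "valid P" if "P \<in> \<P>" for P using D that by (simp add: directed_system_def)
  have common: "\<exists>R\<in>\<P>. X \<subseteq> space R \<and> embeds P R" if X: "finite X" "X \<subseteq> U" and P: "P \<in> \<P>" for X P
  proof -
    have "\<forall>v\<in>X. \<exists>P. P \<in> \<P> \<and> v \<in> space P" using X by (auto simp: U_def)
    from bchoice[OF this] obtain p where p: "\<forall>v\<in>X. p v \<in> \<P> \<and> v \<in> space (p v)" by blast
    have "\<exists>R\<in>\<P>. \<forall>Q\<in>insert P (p ` X). embeds Q R"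
      by (rule directed_system_upper_bound[OF D]) (use X p P in auto)
    then obtain R where R: "R \<in> \<P>" "embeds P R" "\<forall>v\<in>X. embeds (p v) R" by auto
    then have "v \<in> space R" if "v \<in> X" for v using that p embeds_space by blast
    then show ?thesis using R by blast
  qed
  have ep: "empty_piece \<in> \<P>" using D by (simp add: directed_system_def)
  have U: "lin_sub U"
    unfolding lin_sub_def
  proof (intro conjI ballI)
    show "0 \<in> U" using ep lin_sub_0[OF lin_sub_supported] unfolding U_def by blast
    fix v w assume "v \<in> U" "w \<in> U"
    then obtain R where "R \<in> \<P>" "v \<in> space R" "w \<in> space R" using common[of "{v, w}" empty_piece] ep by auto
    then show "v + w \<in> U" unfolding U_def using lin_sub_add[OF lin_sub_supported] by blast
  qed
  \<comment> \<open>The bounds \<open>d\<close> of the value of \<open>v\<close> do not depend on the piece in which they are determined.\<close>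
  define gb where "gb v d \<longleftrightarrow> (\<exists>P\<in>\<P>. v \<in> space P \<and> below P v d)" for v d
  have gb: "gb v d \<longleftrightarrow> below P v d" if P: "P \<in> \<P>" "v \<in> space P" for P v d
  proof
    assume "gb v d"
    then obtain Q where Q: "Q \<in> \<P>" "v \<in> space Q" "below Q v d" by (auto simp: gb_def)
    obtain R where "embeds P R" "embeds Q R" using D P Q unfolding directed_system_def by blast
    then show "below P v d" using embeds_below P Q by blast
  qed (use P in \<open>auto simp: gb_def\<close>)
  define \<Phi> where "\<Phi> v = (SOME s. \<forall>d. s \<le> d \<longleftrightarrow> gb v d)" for v
  have \<Phi>: "\<Phi> v \<le> d \<longleftrightarrow> gb v d" if v: "v \<in> U" for v d
  proof -
    obtain P where P: "P \<in> \<P>" "v \<in> space P" using v by (auto simp: U_def)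
    have "finite (val P ` supp P v)" using valid[OF P(1)] by (auto simp: valid_def supp_def)
    from finite_is_lub_exists[OF this] obtain s where "is_lub s (val P ` supp P v)" by blast
    then have "\<forall>d. s \<le> d \<longleftrightarrow> gb v d" by (simp add: gb[OF P] below_iff_supp is_lub_def)
    then have "\<forall>d. \<Phi> v \<le> d \<longleftrightarrow> gb v d" unfolding \<Phi>_def by (rule someI)
    then show ?thesis by blast
  qed
  have \<Phi>P: "\<Phi> v \<le> d \<longleftrightarrow> below P v d" if P: "P \<in> \<P>" "v \<in> space P" for P v d
    using \<Phi> gb[OF P] P by (auto simp: U_def)
  have \<Phi>_add: "\<Phi> (v + w) \<le> d" if vw: "v \<in> U" "w \<in> U" "\<Phi> v \<le> d" "\<Phi> w \<le> d" for v w d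
  proof -
    obtain R where R: "R \<in> \<P>" "v \<in> space R" "w \<in> space R" using vw common[of "{v, w}" empty_piece] ep by auto
    have "lin_sub (ker R i)" if "i \<in> idx R" for i using valid[OF R(1)] that by (simp add: valid_def)
    moreover have "below R v d" "below R w d" using vw \<Phi>P R by blast+
    ultimately have "below R (v + w) d" unfolding below_def using lin_sub_add by blast
    moreover have "v + w \<in> space R" using lin_sub_add[OF lin_sub_supported] R by blast
    ultimately show ?thesis using \<Phi>P R by blast
  qed
  have \<Phi>0: "\<Phi> 0 \<le> d" for d
  proof -
    have "0 \<in> space (empty_piece :: ('x, 'a) piece)" by (rule lin_sub_0[OF lin_sub_supported])
    then show ?thesis using \<Phi>P[OF ep] by (simp add: below_def empty_piece_def)
  qed
  define N0 where "N0 = {v \<in> U. \<Phi> v \<le> bot}"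
  have N0: "lin_sub N0" unfolding lin_sub_def N0_def using U \<Phi>0 \<Phi>_add lin_sub_0 lin_sub_add by blast
  obtain q where q: "additive q" "\<And>v. q v \<in> N0" "\<And>v. v \<in> N0 \<Longrightarrow> q v = v" using projection_exists[OF N0] by metis
  obtain \<pi> where \<pi>: "additive \<pi>" "\<And>v. \<pi> v \<in> U" "\<And>v. v \<in> U \<Longrightarrow> \<pi> v = v" using projection_exists[OF U] by metis
  interpret q: additive q by fact
  define p where "p v = v + q v" for v
  have p: "additive p" unfolding p_def by (simp add: additive_def q.add ac_simps)
  interpret p: additive p by fact
  define W where "W = {v \<in> U. q v = 0}"
  have W: "lin_sub W" unfolding lin_sub_def W_def using U by (auto simp: q.zero q.add lin_sub_0 lin_sub_add)
  have WU: "W \<subseteq> U" by (auto simp: W_def)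
  have qU: "q v \<in> U" for v using q(2)[of v] by (simp add: N0_def)
  have pW: "p v \<in> W" if "v \<in> U" for v
    using that qU q(3)[OF q(2)[of v]] lin_sub_add[OF U] by (simp add: p_def W_def q.add)
  have pid: "p v = v" if "v \<in> W" for v using that by (simp add: p_def W_def)
  have pN: "p v = 0" if "v \<in> N0" for v using that q(3) by (simp add: p_def)
  have \<Phi>p: "\<Phi> (p v) \<le> d \<longleftrightarrow> \<Phi> v \<le> d" if v: "v \<in> U" for v d
  proof -
    have q0: "\<Phi> (q v) \<le> d" using q(2)[of v] bot_least[of d] unfolding N0_def by (auto intro: order_trans)
    have "\<Phi> v \<le> d" if "\<Phi> (p v) \<le> d"
    proof -
      have "p v + q v = v" by (simp add: p_def add.assoc)
      then show ?thesis using \<Phi>_add[OF _ qU that q0] pW[OF v] WU by auto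
    qed
    then show ?thesis unfolding p_def using \<Phi>_add[OF v qU _ q0] by blast
  qed
  have "module_valuation W \<Phi>"
    unfolding module_valuation_def
  proof (intro conjI ballI allI impI)
    show "lin_sub W" by fact
    fix v assume v: "v \<in> W"
    show "\<Phi> v = bot \<longleftrightarrow> v = 0"
    proof
      assume "\<Phi> v = bot"
      then have "v \<in> N0" using v WU by (auto simp: N0_def)
      then show "v = 0" using q(3) v by (auto simp: W_def)
    next
      assume "v = 0"
      then show "\<Phi> v = bot" using \<Phi>0[of bot] by (simp add: bot_unique)
    qed
    fix w assume w: "w \<in> W"
    show "\<Phi> (v + w) \<le> sup (\<Phi> v) (\<Phi> w)" using v w WU by (intro \<Phi>_add) auto
  next
    show onto: "\<exists>w\<in>W. \<Phi> w = a" for a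
    proof -
      obtain Q w where Q: "Q \<in> \<P>" "w \<in> space Q" "\<And>d. below Q w d \<longleftrightarrow> a \<le> d"
        using covered[of a] unfolding covers_def by blast
      have wU: "w \<in> U" using Q by (auto simp: U_def)
      have "\<Phi> (p w) \<le> d \<longleftrightarrow> a \<le> d" for d using \<Phi>p[OF wU] \<Phi>P[OF Q(1,2)] Q(3) by simp
      then have "\<Phi> (p w) = a" by (meson order_antisym order_refl)
      then show ?thesis using pW[OF wU] by blast
    qed
    {
      fix x y assume x: "x \<in> W" and y: "y \<in> W" and xy: "\<Phi> y \<le> \<Phi> x"
      obtain P where P: "P \<in> \<P>" "x \<in> space P" "y \<in> space P"
        using common[of "{x, y}" empty_piece] ep x y WU by auto
      obtain Q where Q: "Q \<in> \<P>" "embeds P Q" "solves P Q" using solved[OF P(1)] by blast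
      have "below P y d" if "below P x d" for d
        using \<Phi>P[OF P(1,2), of d] \<Phi>P[OF P(1,3), of d] xy that by (meson order_trans)
      then obtain n where n: "n \<in> names Q" "below Q (y + act Q n x) bot"
        using Q(3) P unfolding solves_def by blast
      define G where "G v = act (SOME R. R \<in> \<P> \<and> v \<in> space R \<and> n \<in> names R) n v" for v
      have G: "G v = act R n v" if R: "R \<in> \<P>" "v \<in> space R" "n \<in> names R" for v R
      proof -
        define S where "S = (SOME R. R \<in> \<P> \<and> v \<in> space R \<and> n \<in> names R)"
        have "\<exists>R. R \<in> \<P> \<and> v \<in> space R \<and> n \<in> names R" using R by blast
        from someI_ex[OF this] have S: "S \<in> \<P>" "v \<in> space S" "n \<in> names S" unfolding S_def by blast+
        obtain T where T: "T \<in> \<P>" "embeds R T" "embeds S T" using D R(1) S(1) unfolding directed_system_def by blast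
        have "G v = act S n v" unfolding G_def S_def ..
        also have "\<dots> = act T n v" using embeds_act[OF T(3) S(3,2)] by simp
        also have "\<dots> = act R n v" using embeds_act[OF T(2) R(3,2)] .
        finally show ?thesis .
      qed
      have here: "\<exists>R\<in>\<P>. X \<subseteq> space R \<and> n \<in> names R" if "finite X" "X \<subseteq> U" for X
        using common[OF that Q(1)] embeds_names n(1) by blast
      have pres: "preserves R (act R n)" if "R \<in> \<P>" "n \<in> names R" for R
        using valid that by (simp add: valid_def)
      have G_add: "G (v + w) = G v + G w" if vw: "v \<in> U" "w \<in> U" for v w
      proof -
        obtain R where R: "R \<in> \<P>" "v \<in> space R" "w \<in> space R" "n \<in> names R" using here[of "{v, w}"] vw by auto
        have "v + w \<in> space R" using lin_sub_add[OF lin_sub_supported] R by blast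
        then show ?thesis using G R pres[OF R(1,4)] by (simp add: preserves_def additive_def)
      qed
      have G_\<Phi>: "G v \<in> U \<and> (\<forall>d. \<Phi> v \<le> d \<longrightarrow> \<Phi> (G v) \<le> d)" if v: "v \<in> U" for v
      proof -
        obtain R where R: "R \<in> \<P>" "v \<in> space R" "n \<in> names R" using here[of "{v}"] v by auto
        have pr: "preserves R (act R n)" by (rule pres[OF R(1,3)])
        then have GR: "G v \<in> space R" using G[OF R] R(2) by (simp add: preserves_def)
        moreover have "below R (G v) d" if "below R v d" for d
          using pr that unfolding G[OF R] below_def preserves_def by blast
        ultimately have "\<Phi> v \<le> d \<longrightarrow> \<Phi> (G v) \<le> d" for d using \<Phi>P[OF R(1) GR] \<Phi>P[OF R(1,2)] by blast
        then show ?thesis using GR R(1) by (auto simp: U_def)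
      qed
      have xQ: "x \<in> space Q" "y \<in> space Q" using P Q embeds_space by blast+
      have Gx: "G x = act Q n x" by (rule G[OF Q(1) xQ(1) n(1)])
      have yGx: "y + G x \<in> N0"
      proof -
        have "G x \<in> space Q" using pres[OF Q(1) n(1)] xQ(1) Gx by (simp add: preserves_def)
        then have "y + G x \<in> space Q" using xQ lin_sub_add[OF lin_sub_supported] by blast
        then show ?thesis using n(2) \<Phi>P[OF Q(1)] Q(1) unfolding N0_def U_def Gx by blast
      qed
      show "\<exists>f. additive f \<and> (\<forall>w\<in>W. f w \<in> W \<and> \<Phi> (f w) \<le> \<Phi> w) \<and> f x = y"
      proof (intro exI[of _ "\<lambda>v. p (G (\<pi> v))"] conjI ballI)
        show "additive (\<lambda>v. p (G (\<pi> v)))"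
          using \<pi>(2) by (simp add: additive_def additive.add[OF \<pi>(1)] G_add p.add)
        show "p (G (\<pi> w)) \<in> W" "\<Phi> (p (G (\<pi> w))) \<le> \<Phi> w" if "w \<in> W" for w
          using G_\<Phi>[of w] pW \<Phi>p that WU \<pi>(3) by auto
        have "p (y + G x) = 0" by (rule pN[OF yGx])
        then have "p (G x) = p y" by (simp add: p.add)
        then show "p (G (\<pi> x)) = y" using \<pi>(3) x y WU pid by auto
      qed
    next
      fix y a b assume y: "y \<in> W" and ab: "\<Phi> y \<le> sup a b"
      obtain x1 x2 where x: "x1 \<in> W" "\<Phi> x1 = a" "x2 \<in> W" "\<Phi> x2 = b" using onto by metis
      obtain P where P: "P \<in> \<P>" "x1 \<in> space P" "x2 \<in> space P" "y \<in> space P"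
        using common[of "{x1, x2, y}" empty_piece] ep x y WU by auto
      obtain Q where Q: "Q \<in> \<P>" "embeds P Q" "solves P Q" using solved[OF P(1)] by blast
      have "below P y d" if "below P x1 d" "below P x2 d" for d
      proof -
        have "a \<le> d" "b \<le> d" using that \<Phi>P[OF P(1,2)] \<Phi>P[OF P(1,3)] x by auto
        then have "\<Phi> y \<le> d" using ab by (meson le_supI order_trans)
        then show ?thesis using \<Phi>P[OF P(1,4)] by simp
      qed
      then obtain y1 y2 where yy: "y1 \<in> space Q" "y2 \<in> space Q" "y = y1 + y2"
        "\<And>d. below Q x1 d \<Longrightarrow> below Q y1 d" "\<And>d. below Q x2 d \<Longrightarrow> below Q y2 d"
        using Q(3) P unfolding solves_def by blast
      have xQ: "x1 \<in> space Q" "x2 \<in> space Q" using P Q embeds_space by blast+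
      have yU: "y1 \<in> U" "y2 \<in> U" using yy Q(1) by (auto simp: U_def)
      have "\<Phi> y1 \<le> a" "\<Phi> y2 \<le> b"
        using \<Phi>P[OF Q(1) yy(1)] \<Phi>P[OF Q(1) yy(2)] \<Phi>P[OF Q(1) xQ(1)] \<Phi>P[OF Q(1) xQ(2)] yy(4,5) x
        by (metis order_refl)+
      moreover have "y = p y1 + p y2" using pid[OF y] by (simp add: yy(3) p.add)
      ultimately show "\<exists>y1\<in>W. \<exists>y2\<in>W. y = y1 + y2 \<and> \<Phi> y1 \<le> a \<and> \<Phi> y2 \<le> b"
        using pW[OF yU(1)] pW[OF yU(2)] \<Phi>p[OF yU(1)] \<Phi>p[OF yU(2)] by blast
    }
  qed
  then show ?thesis by blast
qed

section \<open>The module of a valued vector space\<close>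

text \<open>
  The module has to consist of sets of atoms; they are identified with their indicator functions.
\<close>

definition set_of :: "'x bvec \<Rightarrow> 'x set" where "set_of v = {x. v x = 1}"
definition ind :: "'x set \<Rightarrow> 'x bvec" where "ind A x = of_bool (x \<in> A)"

lemma ind_set_of [simp]: "ind (set_of v) = v"
  by (auto simp: ind_def set_of_def fun_eq_iff)

lemma set_of_ind [simp]: "set_of (ind A) = A"
  by (auto simp: ind_def set_of_def)

text \<open>
  The submodule generated by a finite set \<open>X\<close> consists of the vectors of value at most the supremum
  \<open>s\<close> of the values on \<open>X\<close>: such a vector splits into summands of value at most \<open>\<Phi> x\<close> with \<open>x \<in> X\<close>, and
  each of these is the image of \<open>x\<close> under a ring element. As every element of the semilattice is a
  value, \<open>a \<mapsto> {x. \<Phi> x \<le> a}\<close> is a bijection, and it turns joins into sums by the splitting property.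
\<close>

lemma module_of_valuation:
  fixes W :: "('a::bounded_semilattice_sup_bot + nat) bvec set" and \<Phi> :: "('a + nat) bvec \<Rightarrow> 'a"
  assumes val: "module_valuation W \<Phi>"
  shows "\<exists>(R :: 'a scal ring) (M :: ('a scal, 'a vec) module) (\<phi> :: 'a \<Rightarrow> 'a vec set).
           right_module R M \<and> Sub\<^sub>c_iso R M \<phi>"
proof -
  have W: "lin_sub W"
    and \<Phi>0: "\<And>v. v \<in> W \<Longrightarrow> \<Phi> v = bot \<longleftrightarrow> v = 0"
    and \<Phi>add: "\<And>v w. v \<in> W \<Longrightarrow> w \<in> W \<Longrightarrow> \<Phi> (v + w) \<le> sup (\<Phi> v) (\<Phi> w)"
    and onto: "\<And>a. \<exists>w\<in>W. \<Phi> w = a"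
    and cyc: "\<And>x y. x \<in> W \<Longrightarrow> y \<in> W \<Longrightarrow> \<Phi> y \<le> \<Phi> x \<Longrightarrow>
        \<exists>f. additive f \<and> (\<forall>w\<in>W. f w \<in> W \<and> \<Phi> (f w) \<le> \<Phi> w) \<and> f x = y"
    and split: "\<And>y a b. y \<in> W \<Longrightarrow> \<Phi> y \<le> sup a b \<Longrightarrow> 
        \<exists>y1\<in>W. \<exists>y2\<in>W. y = y1 + y2 \<and> \<Phi> y1 \<le> a \<and> \<Phi> y2 \<le> b"
    using val unfolding module_valuation_def by blast+
  have W0: "0 \<in> W" using W by (rule lin_sub_0)
  have Wadd: "v + w \<in> W" if "v \<in> W" "w \<in> W" for v w using W that by (rule lin_sub_add)
  define pl :: "'a vec \<Rightarrow> 'a vec \<Rightarrow> 'a vec" where "pl A B = set_of (ind A + ind B)" for A B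
  have ind_pl [simp]: "ind (pl A B) = ind A + ind B" for A B by (simp add: pl_def)
  have ind_eq: "A = B \<longleftrightarrow> ind A = ind B" for A B :: "'a vec" by (metis set_of_ind)
  define Z :: "'a vec" where "Z = set_of 0"
  have ind_Z [simp]: "ind Z = 0" by (simp add: Z_def)
  define E :: "'a scal set" where
    "E = {F. (\<forall>A B. F (pl A B) = pl (F A) (F B)) \<and> (\<forall>A. ind A \<in> W \<longrightarrow> ind (F A) \<in> W \<and> \<Phi> (ind (F A)) \<le> \<Phi> (ind A))}"
  have E_pl: "F (pl A B) = pl (F A) (F B)" and E_W: "ind A \<in> W \<Longrightarrow> ind (F A) \<in> W"
    and E_\<Phi>: "ind A \<in> W \<Longrightarrow> \<Phi> (ind (F A)) \<le> \<Phi> (ind A)" if "F \<in> E" for F A B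
    using that by (auto simp: E_def)
  have E_plI: "(\<lambda>A. pl (F A) (G A)) \<in> E" if F: "F \<in> E" and G: "G \<in> E" for F G
    unfolding E_def
  proof (intro CollectI conjI allI impI)
    show "pl (F (pl A B)) (G (pl A B)) = pl (pl (F A) (G A)) (pl (F B) (G B))" for A B
      unfolding ind_eq by (simp add: E_pl[OF F] E_pl[OF G] ac_simps)
    fix A :: "'a vec" assume A: "ind A \<in> W"
    show "ind (pl (F A) (G A)) \<in> W" using E_W[OF F A] E_W[OF G A] Wadd by simp
    have "\<Phi> (ind (F A) + ind (G A)) \<le> sup (\<Phi> (ind (F A))) (\<Phi> (ind (G A)))"
      by (rule \<Phi>add[OF E_W[OF F A] E_W[OF G A]])
    also have "\<dots> \<le> \<Phi> (ind A)" using E_\<Phi>[OF F A] E_\<Phi>[OF G A] by simp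
    finally show "\<Phi> (ind (pl (F A) (G A))) \<le> \<Phi> (ind A)" by simp
  qed
  have E_compI: "(\<lambda>A. G (F A)) \<in> E" if F: "F \<in> E" and G: "G \<in> E" for F G
    unfolding E_def
  proof (intro CollectI conjI allI impI)
    show "G (F (pl A B)) = pl (G (F A)) (G (F B))" for A B by (simp add: E_pl[OF F] E_pl[OF G])
    fix A :: "'a vec" assume A: "ind A \<in> W"
    show "ind (G (F A)) \<in> W" by (rule E_W[OF G E_W[OF F A]])
    show "\<Phi> (ind (G (F A))) \<le> \<Phi> (ind A)" by (rule order_trans[OF E_\<Phi>[OF G E_W[OF F A]] E_\<Phi>[OF F A]])
  qed
  have E_id: "(\<lambda>A. A) \<in> E" by (simp add: E_def)
  have \<Phi>_zero: "\<Phi> 0 = bot" using \<Phi>0[OF W0] by simp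
  have E_0: "(\<lambda>A. Z) \<in> E" unfolding E_def ind_eq by (simp add: W0 \<Phi>_zero)
  \<comment> \<open>For right modules the product \<open>F G\<close> applies \<open>F\<close> first.\<close>
  define R :: "'a scal ring" where
    "R = \<lparr>carrier = E, mult = (\<lambda>F G A. G (F A)), one = (\<lambda>A. A), zero = (\<lambda>A. Z), add = (\<lambda>F G A. pl (F A) (G A))\<rparr>"
  define M :: "('a scal, 'a vec) module" where
    "M = \<lparr>carrier = {A. ind A \<in> W}, mult = pl, one = Z, zero = Z, add = pl, smult = (\<lambda>F. F)\<rparr>"
  have gM: "abelian_group M"
    by (rule abelian_groupI) (auto simp: M_def ind_eq Wadd W0 ac_simps intro!: exI)
  have gR: "abelian_group R"
    by (rule abelian_groupI) (auto simp: R_def fun_eq_iff ind_eq E_plI E_0 ac_simps intro!: bexI)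
  have mR: "monoid R"
    by (rule monoidI) (auto simp: R_def E_compI E_id)
  have rR: "ring R"
    by (rule ringI[OF gR mR]) (auto simp: R_def E_pl)
  have rm: "right_module R M"
    by (intro right_module.intro rR gM right_module_axioms.intro) (auto simp: R_def M_def E_W E_pl)
  interpret M: abelian_group M by (rule gM)
  have inv: "inv\<^bsub>add_monoid M\<^esub> A = A" if "A \<in> carrier M" for A
  proof -
    have "A \<oplus>\<^bsub>M\<^esub> A = \<zero>\<^bsub>M\<^esub>" by (simp add: M_def ind_eq)
    then have "\<ominus>\<^bsub>M\<^esub> A = A" using M.minus_equality that by blast
    then show ?thesis by (simp add: a_inv_def)
  qed
  have submodule_iff: "submodule H R M \<longleftrightarrow> H \<subseteq> carrier M \<and> Z \<in> H \<and> (\<forall>A\<in>H. \<forall>B\<in>H. pl A B \<in> H) \<and>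
      (\<forall>F\<in>E. \<forall>A\<in>H. F A \<in> H)" for H
  proof
    assume "submodule H R M"
    then interpret H: submodule H R M .
    show "H \<subseteq> carrier M \<and> Z \<in> H \<and> (\<forall>A\<in>H. \<forall>B\<in>H. pl A B \<in> H) \<and> (\<forall>F\<in>E. \<forall>A\<in>H. F A \<in> H)"
      using H.subset H.one_closed H.m_closed H.smult_closed by (simp add: M_def R_def)
  next
    assume H: "H \<subseteq> carrier M \<and> Z \<in> H \<and> (\<forall>A\<in>H. \<forall>B\<in>H. pl A B \<in> H) \<and> (\<forall>F\<in>E. \<forall>A\<in>H. F A \<in> H)"
    show "submodule H R M"
    proof (intro submodule.intro subgroup.intro submodule_axioms.intro)
      show "inv\<^bsub>add_monoid M\<^esub> A \<in> H" if "A \<in> H" for A using inv that H by auto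
    qed (use H in \<open>auto simp: M_def R_def\<close>)
  qed
  define \<phi> :: "'a \<Rightarrow> 'a vec set" where "\<phi> a = {A. ind A \<in> W \<and> \<Phi> (ind A) \<le> a}" for a
  have sub\<phi>: "submodule (\<phi> a) R M" for a
    unfolding submodule_iff
  proof (intro conjI ballI)
    show "\<phi> a \<subseteq> carrier M" "Z \<in> \<phi> a" by (auto simp: \<phi>_def M_def W0 \<Phi>_zero)
    show "pl A B \<in> \<phi> a" if "A \<in> \<phi> a" "B \<in> \<phi> a" for A B
      using that Wadd \<Phi>add[of "ind A" "ind B"] by (auto simp: \<phi>_def intro: order_trans[OF _ sup_least])
    show "F A \<in> \<phi> a" if "F \<in> E" "A \<in> \<phi> a" for F A
      using that E_W[OF that(1)] E_\<Phi>[OF that(1), of A] by (auto simp: \<phi>_def intro: order_trans)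
  qed
  have \<phi>bot: "\<phi> bot = {Z}"
  proof -
    have "A \<in> \<phi> bot \<longleftrightarrow> A \<in> {Z}" for A
      unfolding singleton_iff ind_eq using \<Phi>0[of "ind A"] W0 by (auto simp: \<phi>_def bot_unique \<Phi>_zero)
    then show ?thesis by blast
  qed
  have \<phi>sup: "\<exists>B C. A = pl B C \<and> B \<in> \<phi> a \<and> C \<in> \<phi> b" if A: "A \<in> \<phi> (sup a b)" for A a b
  proof -
    obtain y1 y2 where y: "y1 \<in> W" "y2 \<in> W" "ind A = y1 + y2" "\<Phi> y1 \<le> a" "\<Phi> y2 \<le> b"
      using split[of "ind A" a b] A by (auto simp: \<phi>_def)
    have "A = pl (set_of y1) (set_of y2)" using y(3) unfolding ind_eq by simp
    moreover have "set_of y1 \<in> \<phi> a" "set_of y2 \<in> \<phi> b" using y by (auto simp: \<phi>_def)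
    ultimately show ?thesis by blast
  qed
  have \<phi>_least: "\<phi> (\<Phi> (ind A)) \<subseteq> H" if H: "submodule H R M" and A: "A \<in> H" for H A
  proof
    fix B assume B: "B \<in> \<phi> (\<Phi> (ind A))"
    have "A \<in> carrier M" using H A unfolding submodule_iff by blast
    then have "ind A \<in> W" by (simp add: M_def)
    then obtain f where f: "additive f" "\<forall>w\<in>W. f w \<in> W \<and> \<Phi> (f w) \<le> \<Phi> w" "f (ind A) = ind B"
      using cyc[of "ind A" "ind B"] B by (auto simp: \<phi>_def)
    have "(\<lambda>A. set_of (f (ind A))) \<in> E"
      unfolding E_def ind_eq using f by (simp add: additive.add)
    then have "set_of (f (ind A)) \<in> H" using H A by (auto simp: submodule_iff)
    then show "B \<in> H" by (simp add: f(3))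
  qed
  have span: "submodule_span R M X = \<phi> s"
    if X: "finite X" "X \<subseteq> carrier M" and s: "is_lub s (\<Phi> ` ind ` X)" for X s
  proof
    have "X \<subseteq> \<phi> s" using X s by (auto simp: \<phi>_def M_def is_lub_def)
    then show "submodule_span R M X \<subseteq> \<phi> s" unfolding submodule_span_def using sub\<phi> by blast
    have "\<phi> s \<subseteq> H" if H: "submodule H R M" and "X \<subseteq> H" for H
      using X(1) \<open>X \<subseteq> H\<close> s
    proof (induction arbitrary: s)
      case empty
      then have "s \<le> bot" unfolding is_lub_def by simp
      then show ?case using \<phi>bot H by (simp add: bot_unique submodule_iff)
    next
      case (insert A X)
      obtain t where t: "is_lub t (\<Phi> ` ind ` X)"
        using finite_is_lub_exists[of "\<Phi> ` ind ` X"] insert.hyps(1) by blast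
      have "b \<le> t" if "b \<in> \<Phi> ` ind ` X" for b using t that unfolding is_lub_def by blast
      then have "\<forall>b\<in>\<Phi> ` ind ` insert A X. b \<le> sup (\<Phi> (ind A)) t" by (simp add: le_supI2)
      then have le: "s \<le> sup (\<Phi> (ind A)) t" using insert.prems(2) unfolding is_lub_def by blast
      have "\<phi> s \<subseteq> \<phi> (sup (\<Phi> (ind A)) t)" unfolding \<phi>_def using order_trans[OF _ le] by blast
      moreover have "\<phi> t \<subseteq> H" using insert.IH[OF _ t] insert.prems(1) by blast
      moreover have "\<phi> (\<Phi> (ind A)) \<subseteq> H" using \<phi>_least[OF H] insert.prems(1) by blast
      moreover have "pl B C \<in> H" if "B \<in> H" "C \<in> H" for B C using H that unfolding submodule_iff by blast
      ultimately show ?case using \<phi>sup by blast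
    qed
    then show "\<phi> s \<subseteq> submodule_span R M X" unfolding submodule_span_def by blast
  qed
  have inj: "inj \<phi>"
  proof (rule injI)
    fix a b assume eq: "\<phi> a = \<phi> b"
    have "a \<le> b" if "\<phi> a = \<phi> b" for a b
    proof -
      obtain w where "w \<in> W" "\<Phi> w = a" using onto by blast
      then have "set_of w \<in> \<phi> b" unfolding that[symmetric] by (simp add: \<phi>_def)
      then show ?thesis using \<open>\<Phi> w = a\<close> by (simp add: \<phi>_def)
    qed
    from this[OF eq] this[OF eq[symmetric]] show "a = b" by (rule order_antisym)
  qed
  have "\<phi> a \<in> Sub\<^sub>c R M" for a
  proof -
    obtain w where w: "w \<in> W" "\<Phi> w = a" using onto by blast
    have "submodule_span R M {set_of w} = \<phi> a"
      by (rule span) (use w in \<open>auto simp: M_def is_lub_def\<close>)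
    then show ?thesis unfolding Sub\<^sub>c_def using w by (force simp: M_def)
  qed
  moreover have "N \<in> range \<phi>" if N: "N \<in> Sub\<^sub>c R M" for N
  proof -
    obtain X where X: "finite X" "X \<subseteq> carrier M" "N = submodule_span R M X" using N unfolding Sub\<^sub>c_def by blast
    obtain s where "is_lub s (\<Phi> ` ind ` X)" using finite_is_lub_exists[of "\<Phi> ` ind ` X"] X(1) by blast
    then show ?thesis using span X by blast
  qed
  ultimately have "bij_betw \<phi> UNIV (Sub\<^sub>c R M)" using inj unfolding bij_betw_def by blast
  moreover have "\<phi> (sup a b) = \<phi> a <+>\<^bsub>M\<^esub> \<phi> b" for a b
  proof -
    have "pl B C \<in> \<phi> (sup a b)" if "B \<in> \<phi> a" "C \<in> \<phi> b" for B C
    proof -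
      have "B \<in> \<phi> (sup a b)" "C \<in> \<phi> (sup a b)" using that by (auto simp: \<phi>_def intro: le_supI1 le_supI2)
      then show ?thesis using sub\<phi>[of "sup a b"] unfolding submodule_iff by blast
    qed
    then have "{pl B C | B C. B \<in> \<phi> a \<and> C \<in> \<phi> b} \<subseteq> \<phi> (sup a b)" by blast
    moreover have "\<phi> (sup a b) \<subseteq> {pl B C | B C. B \<in> \<phi> a \<and> C \<in> \<phi> b}" using \<phi>sup[of _ a b] by blast
    moreover have "\<phi> a <+>\<^bsub>M\<^esub> \<phi> b = {pl B C | B C. B \<in> \<phi> a \<and> C \<in> \<phi> b}"
      unfolding set_add_def' by (auto simp: M_def)
    ultimately show ?thesis by simp
  qed
  ultimately have "Sub\<^sub>c_iso R M \<phi>" unfolding Sub\<^sub>c_iso_def using \<phi>bot by (simp add: M_def)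
  then show ?thesis using rm by blast
qed

theorem theorem4p1:
  assumes "|UNIV :: 'a::distributive_semilattice_sup_bot set| \<le>o cardSuc natLeq"
  shows "\<exists>(R :: 'a scal ring) (M :: ('a scal, 'a vec) module) (\<phi> :: 'a \<Rightarrow> 'a vec set).
           right_module R M \<and> Sub\<^sub>c_iso R M \<phi>"
proof -
  have inf: "infinite (UNIV :: ('a + nat) set)" by (simp flip: UNIV_Plus_UNIV)
  have "|UNIV :: nat set| \<le>o cardSuc natLeq"
    using ordIso_ordLeq_trans[OF card_of_nat cardSuc_ordLeq[OF natLeq_Card_order]] .
  then have "|(UNIV :: 'a set) <+> (UNIV :: nat set)| \<le>o cardSuc natLeq"
    using assms by (intro card_of_Plus_ordLeq_infinite_Field)
      (auto simp: cardSuc_Card_order[OF natLeq_Card_order] cardSuc_finite[OF natLeq_Card_order] Field_natLeq)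
  then have small: "|UNIV :: ('a + nat) set| \<le>o cardSuc natLeq" by simp
  \<comment> \<open>The summand \<open>nat\<close> makes the set of atoms infinite; there \<open>bot\<close> serves as a default value.\<close>
  define t :: "'a + nat \<Rightarrow> 'a" where "t = case_sum (\<lambda>a. a) (\<lambda>_. bot)"
  obtain \<P> :: "('a + nat, 'a) piece set" where P: "directed_system \<P>"
    "\<forall>P\<in>\<P>. \<exists>Q\<in>\<P>. embeds P Q \<and> solves P Q" "\<forall>x. \<exists>Q\<in>\<P>. covers Q (t x)"
    using directed_system_exists[OF inf small, of t] by blast
  have "\<exists>Q\<in>\<P>. covers Q a" for a using P(3)[rule_format, of "Inl a"] by (simp add: t_def)
  then obtain W and \<Phi> :: "('a + nat) bvec \<Rightarrow> 'a" where "module_valuation W \<Phi>"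
    using module_valuation_exists[OF P(1)] P(2) by blast
  then show ?thesis by (rule module_of_valuation)
qed

end
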